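(* If $M:\langle\Gamma\vdash U\rangle$ is derivable and $M\rhd^*_{\beta\eta}N$, then $N:\langle\Gamma\restriction_N\vdash U\rangle$ is derivable.
   Context: Indexes: finite sequences of natural numbers ($\mathcal L_{\mathbb N}$), $\oslash$ empty, $i::L$ prepending $i$, $L::K$ concatenation, $L_1\preceq L_2$ (also $L_2\succeq L_1$) iff $L_2=L_1::L_3$ for some $L_3$. Terms: over a countably infinite set $\mathcal V$ of variables, terms $\mathcal M$, free indexed variables $\mathrm{fv}$, degree $d$, joinability $\diamond$ defined simultaneously: $x^L\in\mathcal M$ ($\mathrm{fv}=\{x^L\}$, $d=L$); $MN\in\mathcal M$ when $d(M)\preceq d(N)$, $M\diamond N$ ($\mathrm{fv}$ union, $d(MN)=d(M)$); $\lambda x^L.M\in\mathcal M$ when $L\succeq d(M)$ ($\mathrm{fv}(M)\setminus\{x^L\}$, $d=d(M)$). $M\diamond N$ iff $x^L\in\mathrm{fv}(M)$, $x^K\in\mathrm{fv}(N)$ imply $L=K$. Terms modulo $\alpha$; substitution $M[x^L:=N]$ defined only if $M\diamond N$, $d(N)=L$. $\rhd_\beta$: least relation compatible with abstraction and application containing $(\lambda x^L.M)N\rhd_\beta M[x^L:=N]$ ($d(N)=L$); $\rhd_\eta$: from $\lambda x^L.(Mx^L)\rhd_\eta M$ ($x^L\notin\mathrm{fv}(M)$); $\rhd_{\beta\eta}=\rhd_\beta\cup\rhd_\eta$; $\rhd^*$ reflexive–transitive closure. Lifting $(x^L)^{+i}=x^{i::L}$, $(M_1M_2)^{+i}=M_1^{+i}M_2^{+i}$,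 $(\lambda x^L.M)^{+i}=\lambda x^{i::L}.M^{+i}$. Types: atomic types $\mathcal A$, expansion variables $\overline e_0,\overline e_1,\dots$; $\mathbb T\subseteq\mathbb U$ with degree $d$: $a\in\mathbb T$ ($d=\oslash$); $U\to T\in\mathbb T$ for $U\in\mathbb U$, $T\in\mathbb T$ ($d=\oslash$); $\omega^L\in\mathbb U$ ($d=L$); $U_1\sqcap U_2\in\mathbb U$ if $d(U_1)=d(U_2)$ (same degree); $\overline e_iU\in\mathbb U$ ($d=i::d(U)$); modulo $\sqcap$ commutative, associative, idempotent, $\overline e_i(U_1\sqcap U_2)=\overline e_iU_1\sqcap\overline e_iU_2$, $\omega^L\sqcap U=U$ ($d(U)=L$), $\overline e_i\omega^K=\omega^{i::K}$. Environments: finite sets of declarations $x^L:U$ ($U\in\mathbb U$, at most one per $x^L$); $\Gamma,\Delta$ disjoint union; $env^\omega_M$ assigns $\omega^L$ to each $x^L\in\mathrm{fv}(M)$; $\Gamma_1\sqcap\Gamma_2$ intersects the types of common variables (of equal degree) and keeps the others; $\overline e_j\Gamma$ replaces each $x^L:U$ by $x^{j::L}:\overline e_jU$; $\Gamma_1\diamond\Gamma_2$ iff $x^L\in\mathrm{dom}\,\Gamma_1$, $x^K\in\mathrm{dom}\,\Gamma_2$ imply $L=K$; $\Gamma\restriction_N$ is the restriction of $\Gamma$ to the variables in $\mathrm{fv}(N)$. Subtyping $\sqsubseteq$: least relation on types, environments and typings $\langle\Gamma\vdash U\rangle$ closed under reflexivity, transitivity, $U_1\sqcap U_2\sqsubseteq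 U_1$ ($d(U_1)=d(U_2)$), $U_1\sqcap U_2\sqsubseteq V_1\sqcap V_2$ if $U_i\sqsubseteq V_i$, $U_1\to T_1\sqsubseteq U_2\to T_2$ if $U_2\sqsubseteq U_1$ and $T_1\sqsubseteq T_2$, $\overline e_iU_1\sqsubseteq\overline e_iU_2$ if $U_1\sqsubseteq U_2$, $\Gamma,y^L:U_1\sqsubseteq\Gamma,y^L:U_2$ if $U_1\sqsubseteq U_2$, $\langle\Gamma_1\vdash U_1\rangle\sqsubseteq\langle\Gamma_2\vdash U_2\rangle$ if $U_1\sqsubseteq U_2$ and $\Gamma_2\sqsubseteq\Gamma_1$. Typing rules ($T\in\mathbb T$, $U\in\mathbb U$): (ax) $x^\oslash:\langle(x^\oslash:T)\vdash T\rangle$; ($\omega$) $M:\langle env^\omega_M\vdash\omega^{d(M)}\rangle$; ($\to_I$) $M:\langle\Gamma,(x^L:U)\vdash T\rangle\Rightarrow\lambda x^L.M:\langle\Gamma\vdash U\to T\rangle$; ($\to'_I$) $M:\langle\Gamma\vdash T\rangle$ and $x^L\notin\mathrm{dom}\,\Gamma\Rightarrow\lambda x^L.M:\langle\Gamma\vdash\omega^L\to T\rangle$; ($\to_E$) $M_1:\langle\Gamma_1\vdash U\to T\rangle$, $M_2:\langle\Gamma_2\vdash U\rangle$, $\Gamma_1\diamond\Gamma_2\Rightarrow M_1M_2:\langle\Gamma_1\sqcap\Gamma_2\vdash T\rangle$; ($\sqcap_I$) $M:\langle\Gamma\vdash U_1\rangle$, $M:\langle\Gamma\vdash U_2\rangle\Rightarrow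 M:\langle\Gamma\vdash U_1\sqcap U_2\rangle$; ($e$) $M:\langle\Gamma\vdash U\rangle\Rightarrow M^{+j}:\langle\overline e_j\Gamma\vdash\overline e_jU\rangle$; ($\sqsubseteq$) $M:\langle\Gamma\vdash U\rangle$ and $\langle\Gamma\vdash U\rangle\sqsubseteq\langle\Gamma'\vdash U'\rangle\Rightarrow M:\langle\Gamma'\vdash U'\rangle$. *)

theory Defs
  imports Main "HOL-Library.Sublist"
begin

text \<open>
  Indexes are lists of naturals; \<open>\<preceq>\<close> on indexes is the library relation \<^const>\<open>prefix\<close>.
  Variables are naturals, and an indexed variable \<open>x\<^sup>L\<close> is the pair \<open>(x, L)\<close>.
\<close>

type_synonym vname = nat
type_synonym index = "nat list"
type_synonym ivar = "vname \<times> index"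


section \<open>Terms\<close>

text \<open>
  Terms modulo \<open>\<alpha>\<close>: free variables are named, bound occurrences are de Bruijn indices (still
  carrying the index of the variable they stand for), so that \<open>\<alpha>\<close>-equivalence is equality.
  The paper's abstraction \<open>\<lambda>x\<^sup>L. M\<close> is the function \<open>lam x L M\<close> below; it binds exactly the free
  occurrences of \<open>x\<^sup>L\<close> in \<open>M\<close>, not those of \<open>x\<^sup>K\<close> for \<open>K \<noteq> L\<close>.  Lemma \<open>lam_eq_iff\<close> states that
  equality of abstractions is \<open>\<alpha>\<close>-conversion.  The set \<open>terms\<close> is generated with \<open>lam\<close>, and so
  contains no dangling bound variables.
\<close>

datatype trm =
    Var vname index
  | BVar nat index
  | App trm trm
  | Abs index trm

primrec bind :: "nat \<Rightarrow> vname \<Rightarrow> index \<Rightarrow> trm \<Rightarrow> trm" where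
  "bind k x L (Var y K) = (if (y, K) = (x, L) then BVar k L else Var y K)"
| "bind k x L (BVar n K) = BVar n K"
| "bind k x L (App M N) = App (bind k x L M) (bind k x L N)"
| "bind k x L (Abs K M) = Abs K (bind (Suc k) x L M)"

definition lam :: "vname \<Rightarrow> index \<Rightarrow> trm \<Rightarrow> trm" where
  "lam x L M = Abs L (bind 0 x L M)"

primrec fv :: "trm \<Rightarrow> ivar set" where
  "fv (Var x L) = {(x, L)}"
| "fv (BVar n L) = {}"
| "fv (App M N) = fv M \<union> fv N"
| "fv (Abs L M) = fv M"

primrec deg :: "trm \<Rightarrow> index" where
  "deg (Var x L) = L"
| "deg (BVar n L) = L"
| "deg (App M N) = deg M"
| "deg (Abs L M) = deg M"

text \<open>\<open>\<diamond>\<close>, used both for terms (on their free variables) and for environments (on their domains).\<close>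

definition joinable :: "ivar set \<Rightarrow> ivar set \<Rightarrow> bool" where
  "joinable A B \<longleftrightarrow> (\<forall>x L K. (x, L) \<in> A \<longrightarrow> (x, K) \<in> B \<longrightarrow> L = K)"

inductive_set terms :: "trm set" where
  Var: "Var x L \<in> terms"
| App: "M \<in> terms \<Longrightarrow> N \<in> terms \<Longrightarrow> prefix (deg M) (deg N) \<Longrightarrow> joinable (fv M) (fv N)
    \<Longrightarrow> App M N \<in> terms"
| lam: "M \<in> terms \<Longrightarrow> prefix (deg M) L \<Longrightarrow> lam x L M \<in> terms"

text \<open>
  Substitution and lifting, as total functions.  Substitution is only ever used where the paper's
  \<open>M[x\<^sup>L := N]\<close> is defined.
\<close>

primrec subst :: "trm \<Rightarrow> vname \<Rightarrow> index \<Rightarrow> trm \<Rightarrow> trm" where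
  "subst (Var y K) x L N = (if (y, K) = (x, L) then N else Var y K)"
| "subst (BVar n K) x L N = BVar n K"
| "subst (App M1 M2) x L N = App (subst M1 x L N) (subst M2 x L N)"
| "subst (Abs K M) x L N = Abs K (subst M x L N)"

primrec lift :: "nat \<Rightarrow> trm \<Rightarrow> trm" where
  "lift i (Var x L) = Var x (i # L)"
| "lift i (BVar n L) = BVar n (i # L)"
| "lift i (App M N) = App (lift i M) (lift i N)"
| "lift i (Abs L M) = Abs (i # L) (lift i M)"

lemma fv_bind: "fv (bind k x L M) = fv M - {(x, L)}"
  by (induction M arbitrary: k) auto

lemma deg_bind [simp]: "deg (bind k x L M) = deg M"
  by (induction M arbitrary: k) auto

lemma fv_lam [simp]: "fv (lam x L M) = fv M - {(x, L)}"
  by (simp add: lam_def fv_bind)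

lemma deg_lam [simp]: "deg (lam x L M) = deg M"
  by (simp add: lam_def)

lemma bind_fresh: "(x, L) \<notin> fv M \<Longrightarrow> bind k x L M = M"
  by (induction M arbitrary: k) auto

lemma subst_lam:
  assumes "(y, K) \<noteq> (x, L)" "(y, K) \<notin> fv N"
  shows "subst (lam y K M) x L N = lam y K (subst M x L N)"
proof -
  have "subst (bind k y K M) x L N = bind k y K (subst M x L N)" for k
    using assms by (induction M arbitrary: k) (auto simp: bind_fresh)
  then show ?thesis by (simp add: lam_def)
qed

lemma lift_lam: "lift i (lam x L M) = lam x (i # L) (lift i M)"
proof -
  have "lift i (bind k x L M) = bind k x (i # L) (lift i M)" for k
    by (induction M arbitrary: k) auto
  then show ?thesis by (simp add: lam_def)
qed

primrec closed_at :: "nat \<Rightarrow> trm \<Rightarrow> bool" where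
  "closed_at k (Var x L) = True"
| "closed_at k (BVar n L) = (n < k)"
| "closed_at k (App M N) = (closed_at k M \<and> closed_at k N)"
| "closed_at k (Abs L M) = closed_at (Suc k) M"

lemma terms_closed: "M \<in> terms \<Longrightarrow> closed_at 0 M"
proof (induction rule: terms.induct)
  case (lam M L x)
  have "closed_at k M \<Longrightarrow> closed_at (Suc k) (bind k x L M)" for k
    by (induction M arbitrary: k) auto
  with lam show ?case by (simp add: lam_def)
qed auto

lemma bind_inj:
  "closed_at k M \<Longrightarrow> closed_at k N \<Longrightarrow> bind k x L M = bind k x L N \<Longrightarrow> M = N"
proof (induction M arbitrary: k N)
  case (Var z J)
  then show ?case by (cases N) (auto split: if_splits)
next
  case (BVar n J)
  then show ?case by (cases N) (auto split: if_splits)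
next
  case (App M1 M2)
  from App.prems App.IH show ?case by (cases N) (auto split: if_splits)
next
  case (Abs J M)
  from Abs.prems Abs.IH show ?case by (cases N) (auto split: if_splits)
qed

lemma lam_eq_iff:
  assumes "M \<in> terms" "N \<in> terms"
  shows "lam x L M = lam y K N \<longleftrightarrow>
    L = K \<and> (x = y \<and> M = N \<or> x \<noteq> y \<and> (y, L) \<notin> fv M \<and> N = subst M x L (Var y L))"
proof -
  have rename: "(y, L) \<notin> fv M \<Longrightarrow> bind k y L (subst M x L (Var y L)) = bind k x L M" for k
    by (induction M arbitrary: k) auto
  have closed: "closed_at k (subst M x L (Var y L))" if "closed_at k M" for k
    using that by (induction M arbitrary: k) auto
  have cl: "closed_at 0 M" "closed_at 0 N" using assms terms_closed by auto
  show ?thesis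
  proof
    assume eq: "lam x L M = lam y K N"
    then have LK: "L = K" and b: "bind 0 x L M = bind 0 y L N" by (auto simp: lam_def)
    show "L = K \<and> (x = y \<and> M = N \<or> x \<noteq> y \<and> (y, L) \<notin> fv M \<and> N = subst M x L (Var y L))"
    proof (cases "x = y")
      case True
      with LK b cl bind_inj[of 0 M N] show ?thesis by simp
    next
      case False
      from b have "fv M - {(x, L)} = fv N - {(y, L)}" by (metis fv_bind)
      with False have fresh: "(y, L) \<notin> fv M" by auto
      from rename[OF fresh, of 0] b have "bind 0 y L (subst M x L (Var y L)) = bind 0 y L N" by simp
      with bind_inj closed cl have "N = subst M x L (Var y L)" by metis
      with False LK fresh show ?thesis by simp
    qed
  next
    assume "L = K \<and> (x = y \<and> M = N \<or> x \<noteq> y \<and> (y, L) \<notin> fv M \<and> N = subst M x L (Var y L))"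
    with rename show "lam x L M = lam y K N" by (auto simp: lam_def)
  qed
qed


section \<open>Reduction\<close>

inductive compat :: "(trm \<Rightarrow> trm \<Rightarrow> bool) \<Rightarrow> trm \<Rightarrow> trm \<Rightarrow> bool" for R where
  base: "R M N \<Longrightarrow> compat R M N"
| lam: "compat R M N \<Longrightarrow> lam x L M \<in> terms \<Longrightarrow> lam x L N \<in> terms \<Longrightarrow> M \<in> terms \<Longrightarrow> N \<in> terms
    \<Longrightarrow> compat R (lam x L M) (lam x L N)"
| app1: "compat R M N \<Longrightarrow> App M P \<in> terms \<Longrightarrow> App N P \<in> terms \<Longrightarrow> compat R (App M P) (App N P)"
| app2: "compat R M N \<Longrightarrow> App P M \<in> terms \<Longrightarrow> App P N \<in> terms \<Longrightarrow> compat R (App P M) (App P N)"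

text \<open>
  In a \<open>\<beta>\<close>-redex only \<open>\<lambda>x\<^sup>L. M\<close> and \<open>N\<close> need be joinable; the condition on \<open>M\<close> and \<open>N\<close>, under which
  \<open>M[x\<^sup>L := N]\<close> is defined, can always be met by choosing the bound variable \<open>x\<close>.
\<close>

inductive beta0 :: "trm \<Rightarrow> trm \<Rightarrow> bool" where
  "M \<in> terms \<Longrightarrow> App (lam x L M) N \<in> terms \<Longrightarrow> joinable (fv M) (fv N) \<Longrightarrow> deg N = L
    \<Longrightarrow> beta0 (App (lam x L M) N) (subst M x L N)"

inductive eta0 :: "trm \<Rightarrow> trm \<Rightarrow> bool" where
  "App M (Var x L) \<in> terms \<Longrightarrow> (x, L) \<notin> fv M \<Longrightarrow> eta0 (lam x L (App M (Var x L))) M"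

definition beta :: "trm \<Rightarrow> trm \<Rightarrow> bool" where
  "beta = compat beta0"

definition eta :: "trm \<Rightarrow> trm \<Rightarrow> bool" where
  "eta = compat eta0"

definition beta_eta :: "trm \<Rightarrow> trm \<Rightarrow> bool" where
  "beta_eta = sup beta eta"


section \<open>Types\<close>

text \<open>
  Types are raw type expressions modulo the congruence generated by the equations on \<open>\<sqinter>\<close>,
  \<open>\<omega>\<close> and the expansion variables.  Raw expressions need not respect the grammar; the sets \<open>TT\<close>
  and \<open>UU\<close> of types are carved out of the quotient.
\<close>

datatype 'a rty =
    RAtom 'a
  | RArr "'a rty" "'a rty"
  | ROmega index
  | RCap "'a rty" "'a rty"
  | RExp nat "'a rty"

primrec rdeg :: "'a rty \<Rightarrow> index" where
  "rdeg (RAtom a) = []"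
| "rdeg (RArr U T) = []"
| "rdeg (ROmega L) = L"
| "rdeg (RCap U V) = rdeg U"
| "rdeg (RExp i U) = i # rdeg U"

inductive tyeq :: "'a rty \<Rightarrow> 'a rty \<Rightarrow> bool" where
  refl: "tyeq U U"
| sym: "tyeq U V \<Longrightarrow> tyeq V U"
| trans: "tyeq U V \<Longrightarrow> tyeq V W \<Longrightarrow> tyeq U W"
| arr: "tyeq U U' \<Longrightarrow> tyeq T T' \<Longrightarrow> tyeq (RArr U T) (RArr U' T')"
| inter: "tyeq U U' \<Longrightarrow> tyeq V V' \<Longrightarrow> tyeq (RCap U V) (RCap U' V')"
| exp: "tyeq U U' \<Longrightarrow> tyeq (RExp i U) (RExp i U')"
| comm: "rdeg U = rdeg V \<Longrightarrow> tyeq (RCap U V) (RCap V U)"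
| assoc: "tyeq (RCap (RCap U V) W) (RCap U (RCap V W))"
| idem: "tyeq (RCap U U) U"
| exp_inter: "tyeq (RExp i (RCap U V)) (RCap (RExp i U) (RExp i V))"
| omega_inter: "rdeg U = L \<Longrightarrow> tyeq (RCap (ROmega L) U) U"
| exp_omega: "tyeq (RExp i (ROmega K)) (ROmega (i # K))"

lemma tyeq_rdeg: "tyeq U V \<Longrightarrow> rdeg U = rdeg V"
  by (induction rule: tyeq.induct) auto

quotient_type 'a ty = "'a rty" / tyeq
  by (intro equivpI reflpI sympI transpI) (blast intro: tyeq.refl tyeq.sym tyeq.trans)+

lift_definition Atom :: "'a \<Rightarrow> 'a ty" is RAtom .
lift_definition Arr :: "'a ty \<Rightarrow> 'a ty \<Rightarrow> 'a ty" is RArr by (rule tyeq.arr)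
lift_definition Omega :: "index \<Rightarrow> 'a ty" is ROmega .
lift_definition Cap :: "'a ty \<Rightarrow> 'a ty \<Rightarrow> 'a ty" is RCap by (rule tyeq.inter)
lift_definition Exp :: "nat \<Rightarrow> 'a ty \<Rightarrow> 'a ty" is RExp by (rule tyeq.exp)
lift_definition tdeg :: "'a ty \<Rightarrow> index" is rdeg by (rule tyeq_rdeg)

inductive_set TT :: "'a ty set" and UU :: "'a ty set" where
  atom: "Atom a \<in> TT"
| arr: "U \<in> UU \<Longrightarrow> T \<in> TT \<Longrightarrow> Arr U T \<in> TT"
| TT: "T \<in> TT \<Longrightarrow> T \<in> UU"
| omega: "Omega L \<in> UU"
| inter: "U1 \<in> UU \<Longrightarrow> U2 \<in> UU \<Longrightarrow> tdeg U1 = tdeg U2 \<Longrightarrow> Cap U1 U2 \<in> UU"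
| exp: "U \<in> UU \<Longrightarrow> Exp i U \<in> UU"


section \<open>Environments\<close>

type_synonym 'a env = "ivar \<rightharpoonup> 'a ty"

definition env :: "'a env \<Rightarrow> bool" where
  "env \<Gamma> \<longleftrightarrow> finite (dom \<Gamma>) \<and> ran \<Gamma> \<subseteq> UU"

definition env_omega :: "trm \<Rightarrow> 'a env" where
  "env_omega M = (\<lambda>(x, L). if (x, L) \<in> fv M then Some (Omega L) else None)"

definition env_inter :: "'a env \<Rightarrow> 'a env \<Rightarrow> 'a env" where
  "env_inter \<Gamma> \<Delta> = (\<lambda>v. case (\<Gamma> v, \<Delta> v) of
      (Some U, Some V) \<Rightarrow> Some (Cap U V)
    | (Some U, None) \<Rightarrow> Some U
    | (None, r) \<Rightarrow> r)"

definition env_exp :: "nat \<Rightarrow> 'a env \<Rightarrow> 'a env" where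
  "env_exp j \<Gamma> = (\<lambda>(x, K). case K of
      [] \<Rightarrow> None
    | i # L \<Rightarrow> if i = j then map_option (Exp j) (\<Gamma> (x, L)) else None)"


section \<open>Subtyping\<close>

inductive sub_ty :: "'a ty \<Rightarrow> 'a ty \<Rightarrow> bool" where
  refl: "U \<in> UU \<Longrightarrow> sub_ty U U"
| trans: "sub_ty U V \<Longrightarrow> sub_ty V W \<Longrightarrow> sub_ty U W"
| inter_E: "U1 \<in> UU \<Longrightarrow> U2 \<in> UU \<Longrightarrow> tdeg U1 = tdeg U2 \<Longrightarrow> sub_ty (Cap U1 U2) U1"
| inter: "sub_ty U1 V1 \<Longrightarrow> sub_ty U2 V2 \<Longrightarrow> tdeg U1 = tdeg U2 \<Longrightarrow> tdeg V1 = tdeg V2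
    \<Longrightarrow> sub_ty (Cap U1 U2) (Cap V1 V2)"
| arr: "sub_ty U2 U1 \<Longrightarrow> sub_ty T1 T2 \<Longrightarrow> T1 \<in> TT \<Longrightarrow> T2 \<in> TT \<Longrightarrow> sub_ty (Arr U1 T1) (Arr U2 T2)"
| exp: "sub_ty U1 U2 \<Longrightarrow> sub_ty (Exp i U1) (Exp i U2)"

inductive sub_env :: "'a env \<Rightarrow> 'a env \<Rightarrow> bool" where
  refl: "env \<Gamma> \<Longrightarrow> sub_env \<Gamma> \<Gamma>"
| trans: "sub_env \<Gamma>1 \<Gamma>2 \<Longrightarrow> sub_env \<Gamma>2 \<Gamma>3 \<Longrightarrow> sub_env \<Gamma>1 \<Gamma>3"
| decl: "env \<Gamma> \<Longrightarrow> (y, L) \<notin> dom \<Gamma> \<Longrightarrow> sub_ty U1 U2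
    \<Longrightarrow> sub_env (\<Gamma>((y, L) \<mapsto> U1)) (\<Gamma>((y, L) \<mapsto> U2))"

inductive sub_typing :: "'a env \<times> 'a ty \<Rightarrow> 'a env \<times> 'a ty \<Rightarrow> bool" where
  refl: "env \<Gamma> \<Longrightarrow> U \<in> UU \<Longrightarrow> sub_typing (\<Gamma>, U) (\<Gamma>, U)"
| trans: "sub_typing \<Phi>1 \<Phi>2 \<Longrightarrow> sub_typing \<Phi>2 \<Phi>3 \<Longrightarrow> sub_typing \<Phi>1 \<Phi>3"
| typing: "sub_ty U1 U2 \<Longrightarrow> sub_env \<Gamma>2 \<Gamma>1 \<Longrightarrow> sub_typing (\<Gamma>1, U1) (\<Gamma>2, U2)"


section \<open>Typing\<close>

text \<open>
  \<open>typing M \<Gamma> U\<close> is derivability of \<open>M : \<langle>\<Gamma> \<turnstile> U\<rangle>\<close>.  Membership of the subject in \<open>terms\<close> and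
  of the types in \<open>UU\<close>, and the agreement of the degrees of \<open>x\<^sup>L\<close> and of its type, are
  required in the axioms and preserved by the other rules; see \<open>typing_wf\<close>.
\<close>

inductive typing :: "trm \<Rightarrow> 'a env \<Rightarrow> 'a ty \<Rightarrow> bool" where
  ax: "T \<in> TT \<Longrightarrow> typing (Var x []) [(x, []) \<mapsto> T] T"
| omega: "M \<in> terms \<Longrightarrow> typing M (env_omega M) (Omega (deg M))"
| arr_I: "typing M (\<Gamma>((x, L) \<mapsto> U)) T \<Longrightarrow> (x, L) \<notin> dom \<Gamma> \<Longrightarrow> T \<in> TT
    \<Longrightarrow> typing (lam x L M) \<Gamma> (Arr U T)"
| arr_I': "typing M \<Gamma> T \<Longrightarrow> (x, L) \<notin> dom \<Gamma> \<Longrightarrow> T \<in> TT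
    \<Longrightarrow> typing (lam x L M) \<Gamma> (Arr (Omega L) T)"
| arr_E: "typing M1 \<Gamma>1 (Arr U T) \<Longrightarrow> typing M2 \<Gamma>2 U \<Longrightarrow> joinable (dom \<Gamma>1) (dom \<Gamma>2) \<Longrightarrow> T \<in> TT
    \<Longrightarrow> typing (App M1 M2) (env_inter \<Gamma>1 \<Gamma>2) T"
| inter_I: "typing M \<Gamma> U1 \<Longrightarrow> typing M \<Gamma> U2 \<Longrightarrow> typing M \<Gamma> (Cap U1 U2)"
| exp: "typing M \<Gamma> U \<Longrightarrow> typing (lift j M) (env_exp j \<Gamma>) (Exp j U)"
| sub: "typing M \<Gamma> U \<Longrightarrow> sub_typing (\<Gamma>, U) (\<Gamma>', U') \<Longrightarrow> typing M \<Gamma>' U'"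

lemma finite_fv: "finite (fv M)"
  by (induction M) auto

lemma deg_lift: "deg (lift i M) = i # deg M"
  by (induction M) auto

lemma fv_lift: "fv (lift i M) = (\<lambda>(x, L). (x, i # L)) ` fv M"
  by (induction M) auto

lemma lift_terms: "M \<in> terms \<Longrightarrow> lift i M \<in> terms"
  by (induction rule: terms.induct)
    (auto simp: lift_lam deg_lift fv_lift joinable_def intro!: terms.intros)

lemma tdeg_simps [simp]:
  "tdeg (Atom a) = []" "tdeg (Arr U T) = []" "tdeg (Omega L) = L"
  "tdeg (Cap U V) = tdeg U" "tdeg (Exp i U) = i # tdeg U"
  by (transfer, simp)+

lemma TT_tdeg: "T \<in> TT \<Longrightarrow> tdeg T = []"
  by (erule TT.cases) auto

lemma sub_ty_wf: "sub_ty U V \<Longrightarrow> U \<in> UU \<and> V \<in> UU \<and> tdeg U = tdeg V"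
  by (induction rule: sub_ty.induct) (auto intro: TT_UU.intros)

definition env_deg :: "'a env \<Rightarrow> bool" where
  "env_deg \<Gamma> \<longleftrightarrow> (\<forall>x L U. \<Gamma> (x, L) = Some U \<longrightarrow> tdeg U = L)"

lemma env_upd: "(y, L) \<notin> dom \<Gamma> \<Longrightarrow> env (\<Gamma>((y, L) \<mapsto> U)) \<longleftrightarrow> env \<Gamma> \<and> U \<in> UU"
  by (auto simp: env_def ran_map_upd domIff)

lemma env_deg_upd:
  "(y, L) \<notin> dom \<Gamma> \<Longrightarrow> env_deg (\<Gamma>((y, L) \<mapsto> U)) \<longleftrightarrow> env_deg \<Gamma> \<and> tdeg U = L"
  unfolding env_deg_def fun_upd_apply domIff by (metis option.distinct(1) option.inject prod.inject)

lemma sub_env_wf: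
  "sub_env \<Gamma> \<Delta> \<Longrightarrow> env \<Gamma> \<and> env \<Delta> \<and> dom \<Gamma> = dom \<Delta> \<and> (env_deg \<Gamma> \<longleftrightarrow> env_deg \<Delta>)"
proof (induction rule: sub_env.induct)
  case (decl \<Gamma> y L U1 U2)
  then show ?case using sub_ty_wf[OF decl(3)] by (simp add: env_upd env_deg_upd del: fun_upd_apply)
qed auto

lemma sub_typing_wf:
  "sub_typing \<Phi> \<Psi> \<Longrightarrow> env (fst \<Psi>) \<and> dom (fst \<Phi>) = dom (fst \<Psi>) \<and>
    (env_deg (fst \<Phi>) \<longleftrightarrow> env_deg (fst \<Psi>)) \<and> snd \<Psi> \<in> UU \<and> tdeg (snd \<Phi>) = tdeg (snd \<Psi>)"
proof (induction rule: sub_typing.induct)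
  case (typing U1 U2 \<Gamma>2 \<Gamma>1)
  then show ?case using sub_ty_wf[OF typing(1)] sub_env_wf[OF typing(2)] by auto
qed auto

lemma dom_env_omega: "dom (env_omega M) = fv M"
  by (auto simp: env_omega_def split: if_splits)

lemma dom_env_inter: "dom (env_inter \<Gamma> \<Delta>) = dom \<Gamma> \<union> dom \<Delta>"
  by (auto simp: env_inter_def dom_def split: option.splits)

lemma dom_env_exp: "dom (env_exp j \<Gamma>) = (\<lambda>(x, L). (x, j # L)) ` dom \<Gamma>"
  by (auto simp: env_exp_def dom_def image_iff split: list.splits if_splits)

lemma typing_wf:
  "typing M \<Gamma> U \<Longrightarrow> M \<in> terms \<and> dom \<Gamma> = fv M \<and> env \<Gamma> \<and> env_deg \<Gamma> \<and> U \<in> UU \<and> tdeg U = deg M"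
proof (induction rule: typing.induct)
  case (ax T x)
  have "env [(x, []) \<mapsto> T]" "env_deg [(x, []) \<mapsto> T]"
    using ax by (auto simp: env_def env_deg_def TT_tdeg intro: TT_UU.intros)
  with ax show ?case
    by (auto simp: TT_tdeg simp del: fun_upd_apply intro: terms.intros TT_UU.intros)
next
  case (omega M)
  have "finite (dom (env_omega M))" by (simp add: dom_env_omega finite_fv)
  moreover have "ran (env_omega M) \<subseteq> UU" "env_deg (env_omega M)"
    by (auto simp: env_deg_def env_omega_def ran_def intro: TT_UU.intros split: if_splits)
  ultimately show ?case using omega
    by (auto simp: env_def dom_env_omega intro: TT_UU.intros)
next
  case (arr_I M \<Gamma> x L U T)
  then have "insert (x, L) (dom \<Gamma>) = fv M" by (simp del: fun_upd_apply)
  with arr_I have "dom \<Gamma> = fv M - {(x, L)}" by blast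
  with arr_I TT_tdeg[of T] show ?case
    by (auto simp: env_upd env_deg_upd simp del: fun_upd_apply intro!: terms.intros TT_UU.intros)
next
  case (arr_I' M \<Gamma> T x L)
  with TT_tdeg[of T] show ?case by (auto intro!: terms.intros TT_UU.intros)
next
  case (arr_E M1 \<Gamma>1 U T M2 \<Gamma>2)
  from arr_E.IH have tm: "M1 \<in> terms" "M2 \<in> terms" and dm: "dom \<Gamma>1 = fv M1" "dom \<Gamma>2 = fv M2"
    and en: "env \<Gamma>1" "env \<Gamma>2" and ed: "env_deg \<Gamma>1" "env_deg \<Gamma>2" and dg: "deg M1 = []"
    by auto
  have u: "V \<in> UU" if "\<Gamma>1 v = Some V \<or> \<Gamma>2 v = Some V" for v V
    using that en ranI[of \<Gamma>1 v V] ranI[of \<Gamma>2 v V] by (auto simp only: env_def)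
  have d: "tdeg V = L" if "\<Gamma>1 (x, L) = Some V \<or> \<Gamma>2 (x, L) = Some V" for x L V
    using that ed by (auto simp only: env_deg_def)
  have w: "W \<in> UU \<and> tdeg W = L" if "env_inter \<Gamma>1 \<Gamma>2 (x, L) = Some W" for x L W
    using that u[of "(x, L)"] d[of x L]
    by (cases "\<Gamma>1 (x, L)"; cases "\<Gamma>2 (x, L)") (auto simp: env_inter_def intro: TT_UU.inter)
  have "ran (env_inter \<Gamma>1 \<Gamma>2) \<subseteq> UU" "env_deg (env_inter \<Gamma>1 \<Gamma>2)"
    using w by (auto simp: ran_def env_deg_def)
  moreover have "App M1 M2 \<in> terms"
    using tm dm dg arr_E.hyps by (intro terms.App) simp_all
  ultimately show ?case
    using en dm dg TT_tdeg[OF \<open>T \<in> TT\<close>] TT_UU.TT[OF \<open>T \<in> TT\<close>]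
    by (simp add: env_def dom_env_inter)
next
  case (inter_I M \<Gamma> U1 U2)
  then show ?case by (auto intro: TT_UU.intros)
next
  case (exp M \<Gamma> U j)
  have *: "\<exists>V L. \<Gamma> (x, L) = Some V \<and> K = j # L \<and> W = Exp j V"
    if "env_exp j \<Gamma> (x, K) = Some W" for x K W
    using that by (cases K) (auto simp: env_exp_def split: if_splits)
  have "ran (env_exp j \<Gamma>) \<subseteq> UU"
  proof
    fix W assume "W \<in> ran (env_exp j \<Gamma>)"
    then obtain x K where "env_exp j \<Gamma> (x, K) = Some W" by (auto simp: ran_def)
    from *[OF this] obtain V L where "\<Gamma> (x, L) = Some V" "W = Exp j V" by blast
    moreover from this exp.IH have "V \<in> UU" unfolding env_def by (meson ranI subsetD)
    ultimately show "W \<in> UU" by (simp add: TT_UU.exp)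
  qed
  moreover have "env_deg (env_exp j \<Gamma>)"
    unfolding env_deg_def
  proof (intro allI impI)
    fix x K W assume "env_exp j \<Gamma> (x, K) = Some W"
    from *[OF this] obtain V L where "\<Gamma> (x, L) = Some V" "K = j # L" "W = Exp j V" by blast
    moreover from this exp.IH have "tdeg V = L" unfolding env_deg_def by metis
    ultimately show "tdeg W = K" by simp
  qed
  moreover have "finite (dom (env_exp j \<Gamma>))" "dom (env_exp j \<Gamma>) = fv (lift j M)"
    using exp.IH finite_fv by (simp_all add: dom_env_exp fv_lift)
  ultimately show ?case
    using exp.IH by (simp add: env_def deg_lift lift_terms TT_UU.exp)
next
  case (sub M \<Gamma> U \<Gamma>' U')
  then show ?case using sub_typing_wf[OF sub(2)] by auto
qed

end

theory Submission
  imports Defs "HOL-Combinatorics.Transposition"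
begin

text \<open>
  One-step subject reduction goes by induction on the typing derivation.  A step out of a lifted
  term \<open>M\<^sup>+\<^sup>j\<close> is the lifting of a step out of \<open>M\<close>, so rule (\<open>e\<close>) causes no trouble, and all other
  non-trivial rules concern degree \<open>\<oslash>\<close>.  There the \<open>\<beta>\<close> case combines inversion of the typing of an
  abstraction with a substitution lemma, and the \<open>\<eta>\<close> case inverts the typing of \<open>M x\<^sup>L\<close>.  Inversion
  is possible because the set of components of a type is invariant under the type equations, and
  subtyping compares components one by one.  Environments are compared pointwise (\<open>covers\<close>), which absorbs both
  the subtyping rule and the restriction to the free variables of the reduct.
\<close>

section \<open>Types\<close>

text \<open>A derivation for \<open>lam x L M\<close> may have abstracted another name from another
  body, so besides the quotient on types the choice of bound names stands in the way of inversion.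
  It is handled by swapping names: \<open>typing\<close> and \<open>red\<close> are stable under
  swaps, and two presentations of one abstraction with a non-vacuous binder differ by a swap
  (\<open>lam_eq_perm\<close>). Swapping names is adequate although binding is by indexed variable,
  because no name is free in a term with two different indices (\<open>joinable_self\<close>).
  Lifting can be undone because the degree of a term is a prefix of all indices in it, free or
  bound; degree \<open>j # K\<close> thus forces every index to start with \<open>j\<close>. The
  substitution lemma needs this for derivations as well: below \<open>lift j\<close> the induction
  hypothesis asks for a lowered argument together with its typing (\<open>typing_lower\<close>).
  Restriction is forced by the system: a typing declares exactly the free variables of its subject,
  and a step can lose some.\<close>

lemma Cap_comm: "tdeg U = tdeg V \<Longrightarrow> Cap U V = Cap V U"
  by transfer (rule tyeq.comm)

lemma Cap_idem [simp]: "Cap U U = U"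
  by transfer (rule tyeq.idem)

lemma Exp_Cap: "Exp i (Cap U V) = Cap (Exp i U) (Exp i V)"
  by transfer (rule tyeq.exp_inter)

lemma Cap_Omega: "tdeg U = L \<Longrightarrow> Cap (Omega L) U = U"
  by transfer (rule tyeq.omega_inter)

lemma Exp_Omega: "Exp i (Omega K) = Omega (i # K)"
  by transfer (rule tyeq.exp_omega)

lemma sub_ty_Omega: "U \<in> UU \<Longrightarrow> sub_ty U (Omega (tdeg U))"
  using sub_ty.inter_E[of "Omega (tdeg U)" U] by (simp add: Cap_Omega TT_UU.omega)

lemma sub_ty_Cap2:
  "U1 \<in> UU \<Longrightarrow> U2 \<in> UU \<Longrightarrow> tdeg U1 = tdeg U2 \<Longrightarrow> sub_ty (Cap U1 U2) U2"
  using sub_ty.inter_E[of U2 U1] by (simp add: Cap_comm)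

lemma sub_ty_CapI:
  assumes "sub_ty W U1" "sub_ty W U2"
  shows "sub_ty W (Cap U1 U2)"
  using sub_ty.inter[OF assms] sub_ty_wf[OF assms(1)] sub_ty_wf[OF assms(2)] by simp

text \<open>
  Every type is an intersection of components \<open>e\<^sub>L a\<close> and \<open>e\<^sub>L (U \<rightarrow> T)\<close>, and the set of
  components is invariant under the equations.  It is what makes inversion of subtyping possible in
  the quotient.
\<close>

primrec rcomps :: "'a rty \<Rightarrow> (index \<times> ('a + 'a ty \<times> 'a ty)) set" where
  "rcomps (RAtom a) = {([], Inl a)}"
| "rcomps (RArr U T) = {([], Inr (abs_ty U, abs_ty T))}"
| "rcomps (ROmega L) = {}"
| "rcomps (RCap U V) = rcomps U \<union> rcomps V"
| "rcomps (RExp i U) = (\<lambda>(L, c). (i # L, c)) ` rcomps U"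

lift_definition comps :: "'a ty \<Rightarrow> (index \<times> ('a + 'a ty \<times> 'a ty)) set" is rcomps
proof -
  fix U V :: "'a rty"
  assume "tyeq U V"
  \<comment> \<open>Congruence under an arrow is the reason for \<open>abs_ty\<close> in
    \<open>rcomps\<close>: congruent raw arguments become equal.\<close>
  then show "rcomps U = rcomps V"
    by (induction rule: tyeq.induct) (auto simp: ty.abs_eq_iff)
qed

lemma comps_simps [simp]:
  "comps (Atom a) = {([], Inl a)}"
  "comps (Omega L) = {}"
  "comps (Cap U V) = comps U \<union> comps V"
  "comps (Exp i U) = (\<lambda>(L, c). (i # L, c)) ` comps U"
  by (transfer, simp)+

lemma comps_Arr [simp]: "comps (Arr U T) = {([], Inr (U, T))}"
  by (induct U rule: ty.abs_induct, induct T rule: ty.abs_induct)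
    (simp add: Arr.abs_eq comps.abs_eq)

text \<open>Types in \<open>TT\<close> are leaves here: the properties proved with this rule never
  recurse under an arrow, so the mutual induction collapses to one predicate.\<close>

lemma UU_induct [consumes 1, case_names TT Omega Cap Exp]:
  assumes "U \<in> UU"
    and "\<And>T. T \<in> TT \<Longrightarrow> P T"
    and "\<And>L. P (Omega L)"
    and "\<And>U V. U \<in> UU \<Longrightarrow> P U \<Longrightarrow> V \<in> UU \<Longrightarrow> P V \<Longrightarrow> tdeg U = tdeg V \<Longrightarrow> P (Cap U V)"
    and "\<And>U i. U \<in> UU \<Longrightarrow> P U \<Longrightarrow> P (Exp i U)"
  shows "P U"
  using assms(1) by (induct rule: TT_UU.inducts(2)[where ?P1.0 = "\<lambda>_. True"]) (auto intro: assms)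

lemma comps_wf:
  "U \<in> UU \<Longrightarrow> (L, Inr (V, S)) \<in> comps U \<Longrightarrow> V \<in> UU \<and> S \<in> TT"
  by (induction arbitrary: L rule: UU_induct) (auto elim: TT.cases)

text \<open>Prefixes of expansion variables are left out, since subtyping never changes the prefix
  of a component.\<close>

fun sub_comp :: "'a + 'a ty \<times> 'a ty \<Rightarrow> 'a + 'a ty \<times> 'a ty \<Rightarrow> bool" where
  "sub_comp (Inl a) (Inl b) \<longleftrightarrow> a = b"
| "sub_comp (Inr (V, S)) (Inr (V', S')) \<longleftrightarrow> sub_ty V' V \<and> sub_ty S S'"
| "sub_comp _ _ \<longleftrightarrow> False"

lemma sub_comp_trans: "sub_comp a b \<Longrightarrow> sub_comp b c \<Longrightarrow> sub_comp a c"
  by (cases a; cases b; cases c) (auto elim: sub_ty.trans)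

lemma sub_comp_refl: "U \<in> UU \<Longrightarrow> (L, c) \<in> comps U \<Longrightarrow> sub_comp c c"
  by (cases c) (auto dest: comps_wf intro!: sub_ty.refl TT_UU.TT)

text \<open>This takes the place of inverting \<open>sub_ty\<close>, which transitivity and the type
  equations prevent. \<open>Omega\<close> has no components and so imposes nothing on its
  subtypes.\<close>

lemma sub_ty_comps:
  "sub_ty U V \<Longrightarrow> (L, c) \<in> comps V \<Longrightarrow> \<exists>b. (L, b) \<in> comps U \<and> sub_comp b c"
proof (induction arbitrary: L c rule: sub_ty.induct)
  case (refl U)
  then show ?case by (blast intro: sub_comp_refl)
next
  case (trans U V W)
  then show ?case by (meson sub_comp_trans)
next
  case (inter_E U1 U2)
  then show ?case by (auto intro: sub_comp_refl)
next
  case (inter U1 V1 U2 V2)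
  then show ?case by simp blast
next
  case (arr U2 U1 T1 T2)
  then show ?case by auto
next
  case (exp U1 U2 i)
  then show ?case by force
qed

text \<open>Reads a component with empty prefix back as a type; on \<open>TT\<close> this recovers
  the type itself (\<open>comps_TT\<close>).\<close>

primrec ty_of_comp :: "'a + 'a ty \<times> 'a ty \<Rightarrow> 'a ty" where
  "ty_of_comp (Inl a) = Atom a"
| "ty_of_comp (Inr p) = Arr (fst p) (snd p)"

lemma comps_TT: "T \<in> TT \<Longrightarrow> \<exists>c. comps T = {([], c)} \<and> ty_of_comp c = T"
  by (erule TT.cases) auto

lemma ty_of_comp_TT: "U \<in> UU \<Longrightarrow> (L, c) \<in> comps U \<Longrightarrow> ty_of_comp c \<in> TT"
  using comps_wf[of U L] by (cases c) (auto intro: TT_UU.atom TT_UU.arr)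

lemma sub_ty_of_comp:
  assumes "U \<in> UU" "V \<in> UU" "(L, b) \<in> comps U" "(K, c) \<in> comps V" "sub_comp b c"
  shows "sub_ty (ty_of_comp b) (ty_of_comp c)"
  using assms comps_wf[of U L] comps_wf[of V K]
  by (cases b; cases c) (auto intro!: sub_ty.arr sub_ty.refl intro: TT_UU.TT TT_UU.atom)

text \<open>On atoms, arrows and \<open>\<omega>\<^sup>\<oslash>\<close> the value is junk; \<open>tdrop\<close> inverts \<open>Exp\<close> on non-empty degrees.\<close>

primrec rdrop :: "'a rty \<Rightarrow> 'a rty" where
  "rdrop (RAtom a) = RAtom a"
| "rdrop (RArr U T) = RArr U T"
| "rdrop (ROmega L) = ROmega (tl L)"
| "rdrop (RCap U V) = RCap (rdrop U) (rdrop V)"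
| "rdrop (RExp i U) = U"

text \<open>Needed for \<open>tdrop\<close> to be well defined: commutativity and the
  \<open>\<omega>\<close> law have degree side conditions, which must survive dropping.\<close>

lemma rdeg_rdrop: "rdeg (rdrop U) = tl (rdeg U)"
  by (induction U) auto

lift_definition tdrop :: "'a ty \<Rightarrow> 'a ty" is rdrop
proof -
  fix U V :: "'a rty"
  assume "tyeq U V"
  then show "tyeq (rdrop U) (rdrop V)"
  proof (induction rule: tyeq.induct)
    case (sym U V)
    then show ?case by (blast intro: tyeq.sym)
  next
    case (trans U V W)
    then show ?case by (blast intro: tyeq.trans)
  qed (simp_all add: rdeg_rdrop tyeq.refl tyeq.arr tyeq.inter tyeq.comm tyeq.assoc tyeq.idem
      tyeq.omega_inter)
qed

lemma tdrop_simps [simp]: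
  "tdrop (Omega L) = Omega (tl L)"
  "tdrop (Cap U V) = Cap (tdrop U) (tdrop V)"
  "tdrop (Exp i U) = U"
  by (transfer, simp add: tyeq.refl)+

lemma tdeg_tdrop [simp]: "tdeg (tdrop U) = tl (tdeg U)"
  by transfer (rule rdeg_rdrop)

text \<open>The degree rules out atoms and arrows; on the remaining types \<open>Exp j\<close> is
  pulled out through the laws for \<open>Cap\<close> and \<open>Omega\<close>.\<close>

lemma Exp_tdrop:
  "U \<in> UU \<Longrightarrow> tdeg U = j # K \<Longrightarrow> Exp j (tdrop U) = U \<and> tdrop U \<in> UU"
  by (induction rule: UU_induct)
    (auto simp: Exp_Cap Exp_Omega TT_tdeg intro: TT_UU.omega TT_UU.inter)

text \<open>Together with \<open>tdrop (Exp j U) = U\<close> this cancels an expansion variable on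
  both sides of a subtyping. The arrow rule is excluded by its empty degree.\<close>

lemma sub_ty_tdrop: "sub_ty U V \<Longrightarrow> tdeg U = j # K \<Longrightarrow> sub_ty (tdrop U) (tdrop V)"
proof (induction arbitrary: K rule: sub_ty.induct)
  case (refl U)
  then show ?case by (auto intro: sub_ty.refl dest: Exp_tdrop)
next
  case (trans U V W)
  then show ?case by (metis sub_ty.trans sub_ty_wf)
next
  case (inter_E U1 U2)
  then show ?case by (auto intro!: sub_ty.inter_E dest: Exp_tdrop)
next
  case (inter U1 V1 U2 V2)
  then show ?case by (auto intro!: sub_ty.inter)
qed auto


section \<open>Environments\<close>

text \<open>Unlike \<open>sub_env\<close>, which forces equal domains, \<Theta> may declare more
  variables than \<Gamma>; the surplus is cut off in \<open>typing_weaken\<close>.\<close>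

definition covers :: "'a env \<Rightarrow> 'a env \<Rightarrow> bool" where
  "covers \<Theta> \<Gamma> \<longleftrightarrow> (\<forall>v U. \<Gamma> v = Some U \<longrightarrow> (\<exists>W. \<Theta> v = Some W \<and> sub_ty W U))"

lemma coversI: "(\<And>v U. \<Gamma> v = Some U \<Longrightarrow> \<exists>W. \<Theta> v = Some W \<and> sub_ty W U) \<Longrightarrow> covers \<Theta> \<Gamma>"
  by (simp add: covers_def)

lemma coversD: "covers \<Theta> \<Gamma> \<Longrightarrow> \<Gamma> v = Some U \<Longrightarrow> \<exists>W. \<Theta> v = Some W \<and> sub_ty W U"
  unfolding covers_def by blast

lemma env_UU: "env \<Gamma> \<Longrightarrow> \<Gamma> v = Some U \<Longrightarrow> U \<in> UU"
  unfolding env_def by (meson ranI subsetD)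

lemma covers_refl: "env \<Gamma> \<Longrightarrow> covers \<Gamma> \<Gamma>"
  by (auto simp: covers_def intro: sub_ty.refl env_UU)

lemma covers_trans: "covers \<Gamma> \<Delta> \<Longrightarrow> covers \<Delta> \<Theta> \<Longrightarrow> covers \<Gamma> \<Theta>"
  unfolding covers_def by (meson sub_ty.trans)

lemma covers_env: "covers \<Gamma> \<Delta> \<Longrightarrow> finite (dom \<Delta>) \<Longrightarrow> env \<Delta>"
  by (force simp: covers_def env_def ran_def dest: sub_ty_wf)

lemma covers_restrict: "covers \<Theta> \<Gamma> \<Longrightarrow> covers \<Theta> (\<Gamma> |` A)"
  by (auto simp: covers_def restrict_map_def)

lemma covers_inter_least:
  assumes "covers \<Theta> \<Gamma>" "covers \<Theta> \<Delta>"
  shows "covers \<Theta> (env_inter \<Gamma> \<Delta>)"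
proof (rule coversI)
  fix v U assume U: "env_inter \<Gamma> \<Delta> v = Some U"
  show "\<exists>W. \<Theta> v = Some W \<and> sub_ty W U"
    using U coversD[OF assms(1), of v] coversD[OF assms(2), of v]
    by (cases "\<Gamma> v"; cases "\<Delta> v") (auto simp: env_inter_def intro: sub_ty_CapI)
qed

lemma restrict_dom: "dom \<Gamma> \<subseteq> A \<Longrightarrow> \<Gamma> |` A = \<Gamma>"
  by (rule ext) (metis domIff restrict_map_def subsetD)

lemma sub_env_covers: "sub_env \<Gamma> \<Delta> \<Longrightarrow> covers \<Gamma> \<Delta>"
proof (induction rule: sub_env.induct)
  case (decl \<Gamma> y L U1 U2)
  then show ?case by (auto simp: covers_def intro: sub_ty.refl env_UU)
next
  case (trans \<Gamma>1 \<Gamma>2 \<Gamma>3)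
  then show ?case using covers_trans by blast
qed (rule covers_refl)

text \<open>A generating step of \<open>sub_env\<close> changes a single declaration, so the types
  of \<Gamma> are exchanged for those of \<Delta> one variable at a time, by induction on the finite
  set already treated.\<close>

lemma covers_sub_env:
  assumes cov: "covers \<Gamma> \<Delta>" and dom: "dom \<Gamma> = dom \<Delta>" and fin: "finite (dom \<Delta>)"
  shows "sub_env \<Gamma> \<Delta>"
proof -
  have sub: "\<exists>A B. \<Gamma> v = Some A \<and> \<Delta> v = Some B \<and> sub_ty A B" if "v \<in> dom \<Delta>" for v
    using that coversD[OF cov] by blast
  have envD: "env \<Delta>" using cov fin by (rule covers_env)
  have envG: "env \<Gamma>"
    unfolding env_def
  proof
    show "ran \<Gamma> \<subseteq> UU"
    proof
      fix A assume "A \<in> ran \<Gamma>"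
      then obtain v where v: "\<Gamma> v = Some A" by (auto simp: ran_def)
      then have "v \<in> dom \<Delta>" using dom by auto
      from sub[OF this] v sub_ty_wf show "A \<in> UU" by auto
    qed
  qed (simp add: dom fin)
  define mix where "mix S = (\<lambda>v. if v \<in> S then \<Delta> v else \<Gamma> v)" for S
  have "finite S \<Longrightarrow> S \<subseteq> dom \<Delta> \<Longrightarrow> sub_env \<Gamma> (mix S)" for S
  proof (induction S rule: finite_induct)
    case empty
    then show ?case using envG by (simp add: mix_def sub_env.refl)
  next
    case (insert v S)
    obtain y L where v: "v = (y, L)" by (cases v)
    obtain A B where AB: "\<Gamma> v = Some A" "\<Delta> v = Some B" "sub_ty A B"
      using sub insert.prems by blast
    \<comment> \<open>Rule \<open>decl\<close> wants \<open>v\<close> undeclared in the common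
      part.\<close>
    let ?G = "(mix S)(v := None)"
    have "dom ?G \<subseteq> dom \<Delta>" using dom by (auto simp: mix_def split: if_splits)
    then have "finite (dom ?G)" using fin finite_subset by blast
    moreover have "ran ?G \<subseteq> UU"
      using envD envG by (auto simp: ran_def mix_def env_UU split: if_splits)
    ultimately have "env ?G" by (simp add: env_def)
    then have "sub_env (?G(v \<mapsto> A)) (?G(v \<mapsto> B))"
      unfolding v using AB by (intro sub_env.decl) auto
    moreover have "?G(v \<mapsto> A) = mix S" "?G(v \<mapsto> B) = mix (insert v S)"
      using AB insert.hyps by (auto simp: mix_def)
    ultimately show ?case using insert sub_env.trans by auto
  qed
  from this[OF fin subset_refl] have "sub_env \<Gamma> (mix (dom \<Delta>))" .
  moreover have "mix (dom \<Delta>) = \<Delta>"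
    using dom by (fastforce simp: mix_def)
  ultimately show ?thesis by simp
qed

lemma sub_typingD:
  "sub_typing \<Phi> \<Psi> \<Longrightarrow> sub_ty (snd \<Phi>) (snd \<Psi>) \<and> covers (fst \<Psi>) (fst \<Phi>)"
proof (induction rule: sub_typing.induct)
  case (trans \<Phi>1 \<Phi>2 \<Phi>3)
  then show ?case by (meson sub_ty.trans covers_trans)
qed (auto intro: sub_ty.refl covers_refl sub_env_covers)

lemma typing_dom: "typing M \<Gamma> U \<Longrightarrow> dom \<Gamma> = fv M"
  using typing_wf by blast

lemma typing_weaken:
  assumes "typing M \<Gamma> U" "covers \<Theta> \<Gamma>" "sub_ty U U'"
  shows "typing M (\<Theta> |` fv M) U'"
proof -
  have dom: "dom \<Gamma> = fv M" using assms(1) typing_wf by blast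
  then have "dom (\<Theta> |` fv M) = dom \<Gamma>"
    using assms(2) unfolding covers_def by (auto simp: restrict_map_def dom_def split: if_splits) blast
  moreover have "covers (\<Theta> |` fv M) \<Gamma>"
    using assms(2) dom unfolding covers_def by (auto simp: restrict_map_def dom_def)
  ultimately have "sub_env (\<Theta> |` fv M) \<Gamma>"
    using dom finite_fv by (intro covers_sub_env) auto
  with assms show ?thesis by (blast intro: typing.sub sub_typing.typing)
qed

lemma typing_sub:
  assumes "typing M \<Gamma> U" "covers \<Theta> \<Gamma>" "dom \<Theta> = fv M" "sub_ty U U'"
  shows "typing M \<Theta> U'"
  using typing_weaken[OF assms(1,2,4)] assms(3) by (simp add: restrict_dom)


section \<open>Terms\<close>

lemma joinable_sym: "joinable A B \<Longrightarrow> joinable B A"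
  unfolding joinable_def by blast

lemma terms_App_iff:
  "App M N \<in> terms \<longleftrightarrow>
    M \<in> terms \<and> N \<in> terms \<and> prefix (deg M) (deg N) \<and> joinable (fv M) (fv N)"
  by (auto intro: terms.App elim: terms.cases simp: lam_def)

text \<open>The term may have been built with another name and body, but \<open>bind\<close>
  preserves the degree of the body, so the condition transfers.\<close>

lemma terms_lam_prefix: "lam x L M \<in> terms \<Longrightarrow> prefix (deg M) L"
  by (erule terms.cases) (auto simp: lam_def dest!: arg_cong[of "bind _ _ _ _" _ deg])

lemma joinable_self: "M \<in> terms \<Longrightarrow> joinable (fv M) (fv M)"
proof (induction rule: terms.induct)
  case (App M N)
  then show ?case unfolding joinable_def by (metis UnE fv.simps(3))
qed (auto simp: joinable_def)

lemma lam_fresh: "(x, L) \<notin> fv M \<Longrightarrow> lam x L M = Abs L M"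
  by (simp add: lam_def bind_fresh)

lemma subst_fresh: "(x, L) \<notin> fv M \<Longrightarrow> subst M x L N = M"
  by (induction M) auto

lemma deg_subst: "deg N = L \<Longrightarrow> deg (subst M x L N) = deg M"
  by (induction M) auto

lemma fv_subst:
  "fv (subst M x L N) = fv M - {(x, L)} \<union> (if (x, L) \<in> fv M then fv N else {})"
  by (induction M) auto

lemma lift_subst: "lift j (subst M x L N) = subst (lift j M) x (j # L) (lift j N)"
  by (induction M) auto

lemma lift_inject [simp]: "lift j M = lift j N \<longleftrightarrow> M = N"
proof
  show "lift j M = lift j N \<Longrightarrow> M = N"
  proof (induction M arbitrary: N)
    case (Var x L) then show ?case by (cases N) auto
  next
    case (BVar n L) then show ?case by (cases N) auto
  next
    case (App M1 M2) then show ?case by (cases N) auto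
  next
    case (Abs L M) then show ?case by (cases N) auto
  qed
qed simp

lemma fv_lift_iff: "(x, K) \<in> fv (lift j M) \<longleftrightarrow> (\<exists>L. K = j # L \<and> (x, L) \<in> fv M)"
  by (force simp: fv_lift)

lemma joinable_lift [simp]: "joinable (fv (lift j M)) (fv (lift j N)) \<longleftrightarrow> joinable (fv M) (fv N)"
  unfolding joinable_def fv_lift_iff by blast

text \<open>In an application the degree of the head is a prefix of that of the argument, in an
  abstraction a prefix of the index of the binder; so a leading \<open>j\<close> spreads to all
  indices.\<close>

lemma terms_lower: "M \<in> terms \<Longrightarrow> deg M = j # K \<Longrightarrow> \<exists>M'\<in>terms. M = lift j M'"
proof (induction arbitrary: K rule: terms.induct)
  case (Var x L)
  then show ?case by (intro bexI[of _ "Var x K"]) (auto intro: terms.Var)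
next
  case (App M N)
  obtain K' where "deg N = j # K'" using App by (auto simp: prefix_def)
  with App obtain M' N' where "M' \<in> terms" "M = lift j M'" "N' \<in> terms" "N = lift j N'"
    by (metis deg.simps(3))
  with App show ?case by (intro bexI[of _ "App M' N'"]) (auto simp: deg_lift intro!: terms.App)
next
  case (lam M L x)
  obtain L' where L: "L = j # L'" using lam by (auto simp: prefix_def)
  obtain M' where "M' \<in> terms" "M = lift j M'" using lam by auto
  with lam L show ?case
    by (intro bexI[of _ "lam x L' M'"]) (auto simp: deg_lift lift_lam intro!: terms.lam)
qed

lemma lift_terms_iff [simp]: "lift j M \<in> terms \<longleftrightarrow> M \<in> terms"
  using terms_lower[of "lift j M" j "deg M"] lift_terms[of M j] by (auto simp: deg_lift)

lemma lam_eq_lift: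
  assumes "lam x L M = lift j P" "M \<in> terms" "prefix (deg M) L"
  shows "\<exists>L' M'. L = j # L' \<and> M = lift j M' \<and> P = lam x L' M'"
proof -
  have d: "deg M = j # deg P" using arg_cong[OF assms(1), of deg] by (simp add: deg_lift)
  then obtain M' where M: "M = lift j M'" using terms_lower assms(2) by blast
  moreover obtain L' where L: "L = j # L'" using assms(3) d by (auto simp: prefix_def)
  ultimately have "lift j (lam x L' M') = lift j P" using assms(1) by (simp add: lift_lam)
  with M L show ?thesis by auto
qed

section \<open>Renaming by permutations of names\<close>

primrec perm :: "(vname \<Rightarrow> vname) \<Rightarrow> trm \<Rightarrow> trm" where
  "perm f (Var x L) = Var (f x) L"
| "perm f (BVar n L) = BVar n L"
| "perm f (App M N) = App (perm f M) (perm f N)"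
| "perm f (Abs L M) = Abs L (perm f M)"

lemma deg_perm [simp]: "deg (perm f M) = deg M"
  by (induction M) auto

lemma fv_perm: "fv (perm f M) = (\<lambda>(x, L). (f x, L)) ` fv M"
  by (induction M) auto

lemma perm_cong: "(\<And>x L. (x, L) \<in> fv M \<Longrightarrow> f x = x) \<Longrightarrow> perm f M = M"
  by (induction M) auto

lemma perm_lift: "perm f (lift j M) = lift j (perm f M)"
  by (induction M) auto

lemma perm_perm: "(\<And>x. f (f x) = x) \<Longrightarrow> perm f (perm f M) = M"
  by (induction M) auto

text \<open>The advantage over substitution: an injective renaming also moves the binder, so no
  freshness condition arises.\<close>

lemma perm_lam: "inj f \<Longrightarrow> perm f (lam x L M) = lam (f x) L (perm f M)"
proof -
  assume "inj f"
  then have "perm f (bind k x L M) = bind k (f x) L (perm f M)" for k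
    by (induction M arbitrary: k) (auto dest: injD)
  then show ?thesis by (simp add: lam_def)
qed

lemma perm_subst: "inj f \<Longrightarrow> perm f (subst M x L N) = subst (perm f M) (f x) L (perm f N)"
  by (induction M) (auto dest: injD)

lemma fv_perm_iff: "inj f \<Longrightarrow> (f x, L) \<in> fv (perm f M) \<longleftrightarrow> (x, L) \<in> fv M"
  by (force simp: fv_perm dest: injD)

lemma joinable_perm: "inj f \<Longrightarrow> joinable (fv M) (fv N) \<Longrightarrow> joinable (fv (perm f M)) (fv (perm f N))"
  unfolding joinable_def fv_perm by (auto dest: injD)

lemma perm_terms:
  assumes "inj f" "M \<in> terms"
  shows "perm f M \<in> terms"
  using assms(2)
  by (induction rule: terms.induct)
    (auto simp: perm_lam[OF assms(1)] intro!: terms.intros joinable_perm[OF assms(1)])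

lemma ex_fresh:
  assumes "finite (A :: ivar set)"
  shows "\<exists>z. z \<notin> fst ` A"
  using assms by (meson ex_new_if_finite finite_imageI infinite_UNIV_nat)

text \<open>
  Instead of renaming the bound variable of \<open>\<lambda>y\<^sup>K. M\<close> away from \<open>N\<close>, we rename \<open>N\<close> away from \<open>y\<close>:
  the induction hypothesis for \<open>M\<close> then applies, and \<open>f\<close> can be undone afterwards.
\<close>

lemma avoid_capture:
  assumes "M \<in> terms" "(y, K) \<in> fv M" "(x, L) \<in> fv (lam y K M)"
    and "joinable (fv (lam y K M)) (fv N)"
  obtains f where "\<And>w. f (f w) = w" "inj f" "f x = x"
    and "\<And>w B. (w, B) \<in> fv (lam y K M) \<Longrightarrow> f w = w"
    and "(y, K) \<notin> fv (perm f N)" "joinable (fv M) (fv (perm f N))"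
proof -
  obtain z where z: "z \<notin> fst ` (fv M \<union> fv N)"
    using ex_fresh[of "fv M \<union> fv N"] finite_fv by blast
  define f where "f = transpose y z"
  have ff: "f (f w) = w" for w by (simp add: f_def)
  have inj: "inj f" by (metis ff injI)
  have fix_: "f w = w" if "(w, B) \<in> fv (lam y K M)" for w B
  proof -
    \<comment> \<open>By \<open>joinable_self\<close> the name \<open>y\<close> is free in
      \<open>M\<close> only with index \<open>K\<close>, and that occurrence is bound.\<close>
    have "w \<noteq> y" using that assms(2) joinable_self[OF assms(1)] unfolding joinable_def by auto
    moreover have "w \<noteq> z" using that z by force
    ultimately show ?thesis by (simp add: f_def)
  qed
  have y: "(y, B) \<notin> fv (perm f N)" for B
  proof
    assume "(y, B) \<in> fv (perm f N)"
    then have "(z, B) \<in> fv N" using fv_perm_iff[OF inj, of z] by (simp add: f_def)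
    with z show False by force
  qed
  have "joinable (fv M) (fv (perm f N))"
    unfolding joinable_def
  proof (intro allI impI)
    fix w A B assume M: "(w, A) \<in> fv M" and N: "(w, B) \<in> fv (perm f N)"
    then have w: "(w, A) \<in> fv (lam y K M)" using y by auto
    with N fix_ have "(w, B) \<in> fv N" using fv_perm_iff[OF inj, of w] by metis
    with w assms(4) show "A = B" unfolding joinable_def by blast
  qed
  with that ff inj fix_ assms(3) y show ?thesis by blast
qed

lemma subst_terms:
  "M \<in> terms \<Longrightarrow> N \<in> terms \<Longrightarrow> deg N = L \<Longrightarrow> joinable (fv M) (fv N) \<Longrightarrow> subst M x L N \<in> terms"
proof (induction arbitrary: N rule: terms.induct)
  case (Var y K)
  then show ?case by (auto intro: terms.Var)
next
  case (App M1 M2)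
  have j: "joinable (fv M1) (fv N)" "joinable (fv M2) (fv N)"
    using App.prems(3) by (auto simp: joinable_def)
  \<comment> \<open>Two free variables that both stem from \<open>N\<close> agree because
    \<open>N\<close> is joinable with itself.\<close>
  have "joinable (fv (subst M1 x L N)) (fv (subst M2 x L N))"
    using j joinable_sym[OF j(1)] joinable_sym[OF j(2)] App.hyps(4) joinable_self[OF App.prems(1)]
    unfolding joinable_def fv_subst by (auto split: if_splits)
  with App j show ?case by (auto simp: deg_subst intro!: terms.App)
next
  case (lam M K y)
  consider "(x, L) \<notin> fv (lam y K M)" | "(x, L) \<in> fv (lam y K M)" "(y, K) \<notin> fv M"
    | "(x, L) \<in> fv (lam y K M)" "(y, K) \<in> fv M" by blast
  then show ?case
  proof cases
    case 1
    with lam.hyps show ?thesis using subst_fresh terms.lam by metis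
  next
    case 2
    \<comment> \<open>The binder is vacuous in \<open>M\<close>, but \<open>N\<close> may contain it
      free; a fresh name avoids the capture.\<close>
    obtain z where "z \<notin> fst ` fv (subst M x L N)" using ex_fresh finite_fv by blast
    then have "(z, K) \<notin> fv (subst M x L N)" by force
    then have "subst (lam y K M) x L N = lam z K (subst M x L N)"
      using 2 by (simp add: lam_fresh)
    moreover have "subst M x L N \<in> terms"
      using lam.IH lam.prems 2 by simp
    ultimately show ?thesis using lam.hyps lam.prems by (simp add: deg_subst terms.lam)
  next
    case 3
    obtain f where f: "\<And>w. f (f w) = w" "inj f" "f x = x"
      "\<And>w B. (w, B) \<in> fv (lam y K M) \<Longrightarrow> f w = w"
      "(y, K) \<notin> fv (perm f N)" "joinable (fv M) (fv (perm f N))"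
      using avoid_capture[OF lam.hyps(1) 3(2,1) lam.prems(3)] by metis
    have "subst M x L (perm f N) \<in> terms"
      using f lam.prems by (intro lam.IH) (auto intro: perm_terms)
    then have "lam y K (subst M x L (perm f N)) \<in> terms"
      using lam.hyps lam.prems by (intro terms.lam) (auto simp: deg_subst)
    also have "lam y K (subst M x L (perm f N)) = subst (lam y K M) x L (perm f N)"
      using f 3 by (subst subst_lam) auto
    \<comment> \<open>Applying \<open>f\<close> again restores \<open>N\<close> and fixes both
      \<open>x\<close> and the abstraction.\<close>
    finally have "perm f (subst (lam y K M) x L (perm f N)) \<in> terms"
      using f(2) perm_terms by blast
    moreover have "perm f (lam y K M) = lam y K M" using f(4) by (rule perm_cong)
    ultimately show ?thesis using f(1-3) by (simp add: perm_subst perm_perm)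
  qed
qed

section \<open>Equal abstractions with different bound names\<close>

lemma subst_Var_perm:
  "(\<And>w B. (w, B) \<in> fv M \<Longrightarrow> (w, B) \<noteq> (y, L) \<Longrightarrow> w \<noteq> x \<and> w \<noteq> y) \<Longrightarrow>
    subst M y L (Var x L) = perm (transpose y x) M"
proof (induction M)
  case (Var z K)
  then show ?case by (cases "(z, K) = (y, L)") auto
next
  case (App M1 M2)
  have "subst M1 y L (Var x L) = perm (transpose y x) M1"
    by (rule App.IH(1), rule App.prems) simp_all
  moreover have "subst M2 y L (Var x L) = perm (transpose y x) M2"
    by (rule App.IH(2), rule App.prems) simp_all
  ultimately show ?case by simp
next
  case (Abs K M)
  have "subst M y L (Var x L) = perm (transpose y x) M"
    by (rule Abs.IH, rule Abs.prems) simp_all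
  then show ?case by simp
next
  case (BVar n K)
  show ?case by simp
qed

lemma lam_eq_perm:
  assumes "M \<in> terms" "N \<in> terms" "lam y L M = lam x L N" "(y, L) \<in> fv M"
  shows "N = perm (transpose y x) M"
    and "\<And>w B. (w, B) \<in> fv M \<Longrightarrow> (w, B) \<noteq> (y, L) \<Longrightarrow> w \<noteq> x \<and> w \<noteq> y"
proof -
  have y: "w \<noteq> y" if "(w, B) \<in> fv M" "(w, B) \<noteq> (y, L)" for w B
    using that assms(4) joinable_self[OF assms(1)] unfolding joinable_def by blast
  have "N = perm (transpose y x) M \<and> (\<forall>w B. (w, B) \<in> fv M \<longrightarrow> (w, B) \<noteq> (y, L) \<longrightarrow> w \<noteq> x)"
  proof (cases "x = y")
    case True
    with assms have "N = M" using lam_eq_iff by metis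
    with True y show ?thesis by (metis perm_cong transpose_same id_apply)
  next
    case False
    with assms have x: "(x, L) \<notin> fv M" and N: "N = subst M y L (Var x L)"
      using lam_eq_iff[OF assms(1,2), of y L x L] by auto
    \<comment> \<open>Otherwise \<open>N\<close>, which has \<open>x\<close> in place of
      \<open>y\<close>, would contain \<open>x\<close> free with the two indices \<open>B\<close>
      and \<open>L\<close>.\<close>
    have w: "w \<noteq> x" if "(w, B) \<in> fv M" "(w, B) \<noteq> (y, L)" for w B
    proof
      assume "w = x"
      with that have "(x, B) \<in> fv N" "(x, L) \<in> fv N"
        using assms(4) by (auto simp: N fv_subst)
      then have "B = L" using joinable_self[OF assms(2)] unfolding joinable_def by blast
      with x that \<open>w = x\<close> show False by blast
    qed
    have "subst M y L (Var x L) = perm (transpose y x) M"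
      using w y by (intro subst_Var_perm) blast
    with w N show ?thesis by blast
  qed
  with y show "N = perm (transpose y x) M"
    and "\<And>w B. (w, B) \<in> fv M \<Longrightarrow> (w, B) \<noteq> (y, L) \<Longrightarrow> w \<noteq> x \<and> w \<noteq> y" by blast+
qed

lemma lam_eq_fresh:
  assumes "M \<in> terms" "N \<in> terms" "lam y L M = lam x L N" "(y, L) \<notin> fv M"
  shows "N = M \<and> (x, L) \<notin> fv M"
  using lam_eq_iff[OF assms(1,2), of y L x L] assms subst_fresh by auto


section \<open>Reduction\<close>

text \<open>Closing both contractions together gives one induction instead of two;
  \<open>beta_eta_red\<close> embeds \<open>beta_eta\<close>.\<close>

abbreviation red :: "trm \<Rightarrow> trm \<Rightarrow> bool" where
  "red \<equiv> compat (\<lambda>M N. beta0 M N \<or> eta0 M N)"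

lemma compat_mono: "compat R M N \<Longrightarrow> (\<And>M N. R M N \<Longrightarrow> S M N) \<Longrightarrow> compat S M N"
  by (induction rule: compat.induct) (auto intro: compat.intros)

lemma beta_eta_red: "beta_eta M N \<Longrightarrow> red M N"
  unfolding beta_eta_def beta_def eta_def by (auto elim!: compat_mono)

lemma beta0_wf:
  assumes "beta0 M N"
  shows "M \<in> terms \<and> N \<in> terms \<and> fv N \<subseteq> fv M \<and> deg N = deg M"
  using assms
proof cases
  case (1 P x L Q)
  then show ?thesis
    by (auto simp: deg_subst fv_subst terms_App_iff intro!: subst_terms split: if_splits)
qed

lemma eta0_wf:
  assumes "eta0 M N"
  shows "M \<in> terms \<and> N \<in> terms \<and> fv N \<subseteq> fv M \<and> deg N = deg M"
  using assms
proof cases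
  case (1 x L)
  then show ?thesis by (auto simp: terms_App_iff intro!: terms.intros)
qed

lemma red_wf: "red M N \<Longrightarrow> M \<in> terms \<and> N \<in> terms \<and> fv N \<subseteq> fv M \<and> deg N = deg M"
  by (induction rule: compat.induct) (auto dest: beta0_wf eta0_wf)

lemma red_perm: "red M N \<Longrightarrow> inj f \<Longrightarrow> red (perm f M) (perm f N)"
proof (induction rule: compat.induct)
  case (base M N)
  from base.hyps have "beta0 (perm f M) (perm f N) \<or> eta0 (perm f M) (perm f N)"
  proof
    assume "beta0 M N"
    then show ?thesis
    proof cases
      case (1 P x L Q)
      then have "App (lam (f x) L (perm f P)) (perm f Q) \<in> terms"
        using perm_terms[OF base.prems, of M] base.prems by (simp add: perm_lam)
      with 1 base.prems show ?thesis
        by (auto simp: perm_lam perm_subst intro!: beta0.intros perm_terms joinable_perm)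
    qed
  next
    assume "eta0 M N"
    then show ?thesis
    proof cases
      case (1 x L)
      then have "App (perm f N) (Var (f x) L) \<in> terms"
        using perm_terms[OF base.prems, of "App N (Var x L)"] by simp
      with 1 base.prems show ?thesis
        by (auto simp: perm_lam fv_perm_iff intro!: eta0.intros)
    qed
  qed
  then show ?case by (rule compat.base)
next
  case (lam M N x L)
  then show ?case
    using perm_terms[OF lam.prems, of "lam x L M"] perm_terms[OF lam.prems, of "lam x L N"]
    by (auto simp: perm_lam intro!: compat.lam perm_terms)
next
  case (app1 M N P)
  then show ?case
    using perm_terms[OF app1.prems, of "App M P"] perm_terms[OF app1.prems, of "App N P"]
    by (auto intro!: compat.app1)
next
  case (app2 M N P)
  then show ?case
    using perm_terms[OF app2.prems, of "App P M"] perm_terms[OF app2.prems, of "App P N"]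
    by (auto intro!: compat.app2)
qed

text \<open>A redex is recognised before lifting: \<open>lam_eq_lift\<close> splits \<open>j\<close>
  off the binder and \<open>lift_terms_iff\<close> returns the side conditions on terms.\<close>

lemma red_lower: "red P N \<Longrightarrow> P = lift j M \<Longrightarrow> \<exists>N'. N = lift j N' \<and> red M N'"
proof (induction arbitrary: M rule: compat.induct)
  case (base P N)
  from base.hyps show ?case
  proof
    assume "beta0 P N"
    then show ?thesis
    proof cases
      case (1 Q x L R)
      with base.prems obtain A B where M: "M = App A B" "lam x L Q = lift j A" "R = lift j B"
        by (cases M) auto
      have "prefix (deg Q) L" using 1 terms_App_iff terms_lam_prefix by blast
      with lam_eq_lift M 1 obtain L' Q' where Q: "L = j # L'" "Q = lift j Q'" "A = lam x L' Q'"
        by blast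
      have "App (lam x L' Q') B \<in> terms"
        using 1 M Q lift_terms_iff[of j "App (lam x L' Q') B"] by (simp add: lift_lam)
      then have "beta0 M (subst Q' x L' B)"
        unfolding M Q using 1 M Q by (intro beta0.intros) (auto simp: deg_lift)
      then have "red M (subst Q' x L' B)" by (auto intro: compat.base)
      moreover have "N = lift j (subst Q' x L' B)" using 1 M Q by (simp add: lift_subst)
      ultimately show ?thesis by blast
    qed
  next
    assume "eta0 P N"
    then show ?thesis
    proof cases
      case (1 x L)
      have "prefix (deg (App N (Var x L))) L" using 1 by (simp add: terms_App_iff)
      with lam_eq_lift 1 base.prems obtain L' Q'
        where Q: "L = j # L'" "App N (Var x L) = lift j Q'" "M = lam x L' Q'" by metis
      then obtain N' A where N: "Q' = App N' A" "N = lift j N'" "Var x L = lift j A"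
        by (cases Q') auto
      from N(3) Q(1) have A: "A = Var x L'" by (cases A) auto
      have "App N' (Var x L') \<in> terms"
        using 1 Q N lift_terms_iff[of j "App N' (Var x L')"] by simp
      moreover have "(x, L') \<notin> fv N'" using 1 N Q by (auto simp: fv_lift_iff)
      ultimately have "eta0 M N'" unfolding Q N A by (rule eta0.intros)
      with N show ?thesis by (auto intro!: compat.base)
    qed
  qed
next
  case (lam P N x L)
  have "prefix (deg P) L" using lam terms_lam_prefix by blast
  with lam_eq_lift lam.prems lam.hyps obtain L' Q
    where Q: "L = j # L'" "P = lift j Q" "M = lam x L' Q" by blast
  with lam.IH obtain N' where N: "N = lift j N'" "red Q N'" by blast
  have "lam x L' Q \<in> terms" "lam x L' N' \<in> terms"
    using lam.hyps Q N lift_terms_iff[of j "lam x L' Q"] lift_terms_iff[of j "lam x L' N'"]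
    by (auto simp: lift_lam)
  then have "red (lam x L' Q) (lam x L' N')"
    using lam.hyps Q N by (intro compat.lam) auto
  with Q N show ?case by (metis lift_lam)
next
  case (app1 P N R)
  then obtain A B where M: "M = App A B" "P = lift j A" "R = lift j B" by (cases M) auto
  with app1.IH obtain N' where N: "N = lift j N'" "red A N'" by blast
  have "App A B \<in> terms" "App N' B \<in> terms"
    using app1.hyps M N lift_terms_iff[of j "App A B"] lift_terms_iff[of j "App N' B"] by auto
  with M N show ?case by (auto intro!: exI[of _ "App N' B"] compat.app1)
next
  case (app2 P N R)
  then obtain A B where M: "M = App A B" "R = lift j A" "P = lift j B" by (cases M) auto
  with app2.IH obtain N' where N: "N = lift j N'" "red B N'" by blast
  have "App A B \<in> terms" "App A N' \<in> terms"
    using app2.hyps M N lift_terms_iff[of j "App A B"] lift_terms_iff[of j "App A N'"] by auto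
  with M N show ?case by (auto intro!: exI[of _ "App A N'"] compat.app2)
qed

text \<open>The step may come with its own representative \<open>lam y L M1\<close> of the
  abstraction; a swap of \<open>y\<close> and \<open>x\<close> carries it over to the given body
  \<open>M\<close>. A \<beta>-redex is never an abstraction.\<close>

lemma red_lam_cases:
  assumes "red (lam x L M) N" "M \<in> terms"
  obtains (lam) N' where "N = lam x L N'" "red M N'"
    | (eta) "M = App N (Var x L)" "(x, L) \<notin> fv N"
  using assms(1)
proof cases
  case base
  then have "eta0 (lam x L M) N" by (auto simp: lam_def elim: beta0.cases)
  then show ?thesis
  proof cases
    case (1 y K)
    then have K: "K = L" and eq: "lam y L (App N (Var y L)) = lam x L M" by (auto simp: lam_def)
    have "M = App N (Var x L)" "(x, L) \<notin> fv N"
      using lam_eq_iff[THEN iffD1, OF _ assms(2) eq] 1 K by (auto simp: subst_fresh)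
    with eta show ?thesis by blast
  qed
next
  case (lam M1 N1 y K)
  then have K: "K = L" and eq: "lam y L M1 = lam x L M" by (auto simp: lam_def)
  have sub: "fv N1 \<subseteq> fv M1" using red_wf lam by blast
  show ?thesis
  proof (cases "(y, L) \<in> fv M1")
    case True
    let ?f = "transpose y x"
    note eqs = lam_eq_perm[OF lam(6) assms(2) eq True]
    have "red M (perm ?f N1)" using eqs(1) red_perm lam by (simp add: inj_transpose)
    moreover have "perm ?f (lam y L N1) = lam y L N1"
    proof (rule perm_cong)
      fix w B assume "(w, B) \<in> fv (lam y L N1)"
      with eqs(2) sub have "w \<noteq> x \<and> w \<noteq> y" by auto
      then show "?f w = w" by simp
    qed
    then have "N = lam x L (perm ?f N1)" using lam K by (simp add: perm_lam inj_transpose)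
    ultimately show ?thesis using that(1) by blast
  next
    case False
    with lam_eq_fresh[OF lam(6) assms(2) eq] have M: "M = M1" "(x, L) \<notin> fv M1" by auto
    with sub False have "lam y L N1 = lam x L N1" by (metis lam_fresh subsetD)
    with lam M K have "N = lam x L N1" "red M N1" by simp_all
    then show ?thesis using that(1) by blast
  qed
qed (simp_all add: lam_def)

lemma red_App_cases:
  assumes "red (App M P) N"
  obtains (left) N' where "N = App N' P" "red M N'"
    | (right) N' where "N = App M N'" "red P N'"
    | (beta) x L Q where "M = lam x L Q" "N = subst Q x L P" "Q \<in> terms"
        "joinable (fv Q) (fv P)" "deg P = L"
  using assms
proof cases
  case base
  then have "beta0 (App M P) N" by (auto simp: lam_def elim: eta0.cases)
  then show ?thesis by cases (use beta in blast)
qed (use left right in \<open>auto simp: lam_def\<close>)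

lemma red_Var: "\<not> red (Var x L) N"
proof
  assume "red (Var x L) N"
  then show False by cases (auto simp: lam_def elim: beta0.cases eta0.cases)
qed


section \<open>Typing\<close>

lemma sub_ty_refl: "typing M \<Gamma> U \<Longrightarrow> sub_ty U U"
  using typing_wf sub_ty.refl by blast

lemma typing_UU: "typing M \<Gamma> U \<Longrightarrow> \<Gamma> v = Some V \<Longrightarrow> V \<in> UU"
  using typing_wf env_UU by blast

lemma typing_tdeg: "typing M \<Gamma> U \<Longrightarrow> \<Gamma> (x, L) = Some V \<Longrightarrow> tdeg V = L"
  using typing_wf unfolding env_deg_def by blast

section \<open>Renaming in derivations\<close>

definition env_perm :: "(vname \<Rightarrow> vname) \<Rightarrow> 'a env \<Rightarrow> 'a env" where
  "env_perm f \<Gamma> = (\<lambda>(x, L). \<Gamma> (f x, L))"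

lemma env_perm_apply [simp]: "env_perm f \<Gamma> (x, L) = \<Gamma> (f x, L)"
  by (simp add: env_perm_def)

text \<open>\<open>f\<close> is taken to be an involution because \<open>env_perm\<close> acts contravariantly.\<close>

lemma typing_perm:
  fixes \<Gamma> :: "'a env"
  assumes "typing M \<Gamma> U" and ff: "\<And>x. f (f x) = x"
  shows "typing (perm f M) (env_perm f \<Gamma>) U"
proof -
  have inj: "inj f" by (metis ff injI)
  have feq: "f a = b \<longleftrightarrow> a = f b" for a b using ff by metis
  show ?thesis
    using assms(1)
  proof (induction rule: typing.induct)
    case (ax T x)
    have "env_perm f [(x, []) \<mapsto> T] = [(f x, []) \<mapsto> T]" by (auto simp: fun_eq_iff feq)
    with ax show ?case by (simp add: typing.ax del: fun_upd_apply)
  next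
    case (omega M)
    have mem: "(f y, K) \<in> fv M \<longleftrightarrow> (y, K) \<in> fv (perm f M)" for y K
      using fv_perm_iff[OF inj, of "f y" K M] by (simp add: ff)
    have "env_perm f (env_omega M :: 'a env) = env_omega (perm f M)"
      by (simp add: fun_eq_iff env_omega_def mem)
    with omega show ?case using typing.omega[OF perm_terms[OF inj omega]] by simp
  next
    case (arr_I M \<Gamma> x L U T)
    have "env_perm f (\<Gamma>((x, L) \<mapsto> U)) = (env_perm f \<Gamma>)((f x, L) \<mapsto> U)"
      by (auto simp: fun_eq_iff feq)
    with arr_I show ?case
      by (auto simp: perm_lam[OF inj] domIff ff simp del: fun_upd_apply intro!: typing.arr_I)
  next
    case (arr_I' M \<Gamma> T x L)
    then show ?case by (auto simp: perm_lam[OF inj] domIff ff intro!: typing.arr_I')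
  next
    case (arr_E M1 \<Gamma>1 U T M2 \<Gamma>2)
    have "env_perm f (env_inter \<Gamma>1 \<Gamma>2) = env_inter (env_perm f \<Gamma>1) (env_perm f \<Gamma>2)"
      by (auto simp: fun_eq_iff env_inter_def split: option.split)
    moreover have "joinable (dom (env_perm f \<Gamma>1)) (dom (env_perm f \<Gamma>2))"
      using arr_E.hyps(3) by (simp add: joinable_def domIff)
    ultimately show ?case using arr_E typing.arr_E by fastforce
  next
    case (inter_I M \<Gamma> U1 U2)
    then show ?case by (blast intro: typing.inter_I)
  next
    case (exp M \<Gamma> U j)
    have "env_perm f (env_exp j \<Gamma>) = env_exp j (env_perm f \<Gamma>)"
      by (auto simp: fun_eq_iff env_exp_def split: list.splits)
    with typing.exp[OF exp.IH] show ?case by (simp add: perm_lift)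
  next
    case (sub M \<Gamma> U \<Gamma>' U')
    have "covers (env_perm f \<Gamma>') (env_perm f \<Gamma>)" and "sub_ty U U'"
      using sub_typingD[OF sub.hyps(2)] by (auto simp: covers_def)
    moreover have "dom \<Gamma>' = fv M"
      using sub.hyps typing.sub typing_dom by blast
    then have "dom (env_perm f \<Gamma>') = fv (perm f M)"
      using fv_perm_iff[OF inj] ff by (auto simp: domIff set_eq_iff) (metis option.distinct(1))+
    ultimately show ?case using sub.IH typing_sub by blast
  qed
qed

text \<open>Declarations whose index does not start with \<open>j\<close> are lost;
  \<open>env_exp_drop\<close> therefore excludes them.\<close>

definition env_drop :: "nat \<Rightarrow> 'a env \<Rightarrow> 'a env" where
  "env_drop j \<Gamma> = (\<lambda>(x, L). map_option tdrop (\<Gamma> (x, j # L)))"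

lemma env_drop_exp: "env_drop j (env_exp j \<Gamma>) = \<Gamma>"
  by (auto simp: env_drop_def env_exp_def fun_eq_iff option.map_comp o_def option.map_ident)

lemma env_exp_apply: "env_exp j \<Gamma> (x, i # L) = (if i = j then map_option (Exp j) (\<Gamma> (x, L)) else None)"
  by (simp add: env_exp_def)

lemma env_exp_SomeD:
  "env_exp j \<Gamma> (x, K) = Some W \<Longrightarrow> \<exists>L V. K = j # L \<and> \<Gamma> (x, L) = Some V \<and> W = Exp j V"
  by (auto simp: env_exp_def split: list.splits if_splits)

lemma covers_env_drop:
  assumes "covers \<Theta> (env_exp j \<Gamma>)"
  shows "covers (env_drop j \<Theta>) \<Gamma>"
proof (rule coversI)
  fix v U assume "\<Gamma> v = Some U"
  moreover obtain x L where v: "v = (x, L)" by (cases v)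
  ultimately have "env_exp j \<Gamma> (x, j # L) = Some (Exp j U)" by (simp add: env_exp_apply)
  from coversD[OF assms this] obtain W where W: "\<Theta> (x, j # L) = Some W" "sub_ty W (Exp j U)"
    by blast
  then have "tdeg W = j # tdeg U" using sub_ty_wf by fastforce
  with W sub_ty_tdrop have "sub_ty (tdrop W) U" by fastforce
  with W v show "\<exists>W. env_drop j \<Theta> v = Some W \<and> sub_ty W U" by (simp add: env_drop_def)
qed

lemma env_exp_drop:
  assumes "env \<Theta>" "env_deg \<Theta>" "\<And>x L. (x, L) \<in> dom \<Theta> \<Longrightarrow> \<exists>K. L = j # K"
  shows "env_exp j (env_drop j \<Theta>) = \<Theta>"
proof -
  have "env_exp j (env_drop j \<Theta>) (x, K) = \<Theta> (x, K)" for x K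
  proof (cases "\<Theta> (x, K)")
    case None
    then show ?thesis by (auto simp: env_exp_def env_drop_def split: list.splits)
  next
    case (Some W)
    then obtain L where K: "K = j # L" using assms(3) by blast
    have "W \<in> UU" "tdeg W = j # L"
      using Some assms K env_UU unfolding env_deg_def by blast+
    with Some K Exp_tdrop show ?thesis by (auto simp: env_exp_def env_drop_def)
  qed
  then show ?thesis by auto
qed

text \<open>The lowered environment and type are given by functions, not just claimed to exist, so
  that the two premises of \<open>inter_I\<close> are lowered to matching judgements.\<close>

lemma typing_lower_aux:
  fixes \<Gamma> :: "'a env"
  assumes "typing M \<Gamma> U" "deg M = j # K"
  shows "\<exists>M'. M = lift j M' \<and> typing M' (env_drop j \<Gamma>) (tdrop U)"
  using assms
proof (induction arbitrary: K rule: typing.induct)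
  case (omega M)
  then obtain M' where M': "M' \<in> terms" "M = lift j M'" using terms_lower by blast
  have "env_drop j (env_omega M :: 'a env) = env_omega M'"
    by (auto simp: env_drop_def env_omega_def fun_eq_iff M' fv_lift_iff)
  moreover have "tdrop (Omega (deg M) :: 'a ty) = Omega (deg M')" by (simp add: M' deg_lift)
  ultimately show ?case using M' typing.omega by metis
next
  case (inter_I M \<Gamma> U1 U2)
  then obtain M' where "M = lift j M'" "typing M' (env_drop j \<Gamma>) (tdrop U1)" by blast
  moreover from inter_I obtain M'' where "M = lift j M''" "typing M'' (env_drop j \<Gamma>) (tdrop U2)"
    by blast
  ultimately show ?case by (auto intro: typing.inter_I)
next
  case (exp M \<Gamma> U i)
  then have "i = j" by (simp add: deg_lift)
  with exp show ?case by (auto simp: env_drop_exp)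
next
  case (sub M \<Gamma> U \<Gamma>' U')
  then obtain M' where M': "M = lift j M'" "typing M' (env_drop j \<Gamma>) (tdrop U)" by blast
  have st: "sub_ty U U'" and cov: "covers \<Gamma>' \<Gamma>" using sub_typingD[OF sub.hyps(2)] by auto
  have "tdeg U = j # K" using sub typing_wf by metis
  with st have "sub_ty (tdrop U) (tdrop U')" using sub_ty_tdrop by blast
  moreover have "covers (env_drop j \<Gamma>') (env_drop j \<Gamma>)"
  proof (rule covers_env_drop)
    have "\<exists>K. L = j # K" if "(x, L) \<in> dom \<Gamma>" for x L
      using that typing_dom[OF sub.hyps(1)] M' by (auto simp: fv_lift_iff)
    then have "env_exp j (env_drop j \<Gamma>) = \<Gamma>"
      using typing_wf[OF sub.hyps(1)] by (intro env_exp_drop) auto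
    with cov show "covers \<Gamma>' (env_exp j (env_drop j \<Gamma>))" by simp
  qed
  moreover have "dom (env_drop j \<Gamma>') = fv M'"
  proof -
    have "dom \<Gamma>' = fv (lift j M')" using sub.hyps typing.sub typing_dom M' by blast
    then have "(x, j # L) \<in> dom \<Gamma>' \<longleftrightarrow> (x, L) \<in> fv M'" for x L by (simp add: fv_lift_iff)
    then show ?thesis by (auto simp: env_drop_def domIff)
  qed
  ultimately show ?case using M' typing_sub by blast
\<comment> \<open>The other rules conclude a type in \<open>TT\<close>, whose degree is
  empty.\<close>
qed (auto dest!: typing_wf TT_tdeg)

lemma typing_lower:
  assumes "typing M \<Gamma> U" "deg M = j # K"
  obtains M' \<Gamma>' U' where "M = lift j M'" "\<Gamma> = env_exp j \<Gamma>'" "U = Exp j U'" "typing M' \<Gamma>' U'"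
proof -
  obtain M' where M': "M = lift j M'" "typing M' (env_drop j \<Gamma>) (tdrop U)"
    using typing_lower_aux[OF assms] by blast
  have "\<exists>K. L = j # K" if "(x, L) \<in> dom \<Gamma>" for x L
    using that typing_dom[OF assms(1)] M' by (auto simp: fv_lift_iff)
  then have "env_exp j (env_drop j \<Gamma>) = \<Gamma>"
    using typing_wf[OF assms(1)] by (intro env_exp_drop) auto
  moreover have "Exp j (tdrop U) = U"
    using typing_wf[OF assms(1)] assms(2) Exp_tdrop by metis
  ultimately show ?thesis using that M' by metis
qed

lemma typing_sub_ty: "typing M \<Gamma> U \<Longrightarrow> sub_ty U U' \<Longrightarrow> typing M \<Gamma> U'"
  using typing_sub typing_wf covers_refl by blast

lemma covers_inter:
  assumes "typing M \<Gamma> U" "typing N \<Delta> V"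
  shows "covers (env_inter \<Gamma> \<Delta>) \<Gamma>" "covers (env_inter \<Gamma> \<Delta>) \<Delta>"
proof -
  note uu = typing_UU[OF assms(1)] typing_UU[OF assms(2)]
  note dg = typing_tdeg[OF assms(1)] typing_tdeg[OF assms(2)]
  show "covers (env_inter \<Gamma> \<Delta>) \<Gamma>"
  proof (rule coversI)
    fix v A assume A: "\<Gamma> v = Some A"
    obtain x L where v: "v = (x, L)" by (cases v)
    show "\<exists>W. env_inter \<Gamma> \<Delta> v = Some W \<and> sub_ty W A"
    proof (cases "\<Delta> v")
      case None
      with A uu(1)[OF A] show ?thesis by (simp add: env_inter_def sub_ty.refl)
    next
      case (Some B)
      with A v uu dg have "sub_ty (Cap A B) A" by (metis sub_ty.inter_E)
      with A Some show ?thesis by (simp add: env_inter_def)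
    qed
  qed
  show "covers (env_inter \<Gamma> \<Delta>) \<Delta>"
  proof (rule coversI)
    fix v B assume B: "\<Delta> v = Some B"
    obtain x L where v: "v = (x, L)" by (cases v)
    show "\<exists>W. env_inter \<Gamma> \<Delta> v = Some W \<and> sub_ty W B"
    proof (cases "\<Gamma> v")
      case None
      with B uu(2)[OF B] show ?thesis by (simp add: env_inter_def sub_ty.refl)
    next
      case (Some A)
      with B v uu dg have "sub_ty (Cap A B) B" by (metis sub_ty_Cap2)
      with B Some show ?thesis by (simp add: env_inter_def)
    qed
  qed
qed

section \<open>Inversion of typings\<close>

lemma typing_Var_inv:
  assumes "typing (Var x L) \<Gamma> V"
  obtains W where "\<Gamma> = [(x, L) \<mapsto> W]" "sub_ty W V"
proof -
  have "\<exists>W. \<Gamma> (x, L) = Some W \<and> sub_ty W V" if "typing P \<Gamma> V" "P = Var x L" for P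
    using that
  proof (induction arbitrary: L rule: typing.induct)
    case (ax T y)
    then show ?case by (auto intro!: sub_ty.refl TT_UU.TT)
  next
    case (omega M)
    then show ?case by (auto simp: env_omega_def intro!: sub_ty.refl TT_UU.omega)
  next
    case (inter_I M \<Gamma> U1 U2)
    then show ?case using sub_ty_CapI by fastforce
  next
    case (exp M \<Gamma> U j)
    obtain K where "L = j # K" "M = Var x K" using exp.prems by (cases M) auto
    with exp.IH[of K] show ?case by (auto simp: env_exp_apply intro: sub_ty.exp)
  next
    case (sub M \<Gamma> U \<Gamma>' U')
    then obtain W where "\<Gamma> (x, L) = Some W" "sub_ty W U" by blast
    with sub_typingD[OF sub.hyps(2)] show ?case
      unfolding covers_def by (metis fst_conv snd_conv sub_ty.trans)
  qed (auto simp: lam_def)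
  then obtain W where W: "\<Gamma> (x, L) = Some W" "sub_ty W V" using assms by blast
  moreover obtain W' where "\<Gamma> = [(x, L) \<mapsto> W']"
    using typing_dom[OF assms] by (auto simp: dom_eq_singleton_conv)
  ultimately show ?thesis using that by simp
qed

text \<open>Inside a derivation of an arrow type the type need not be an arrow, so the induction
  follows one component of it. The restriction deletes the declaration of \<open>x\<close> when the
  binder is vacuous.\<close>

lemma typing_lam_inv_aux:
  "typing P \<Gamma> U \<Longrightarrow> P = lam x L M \<Longrightarrow> M \<in> terms \<Longrightarrow> ([], Inr (V, T)) \<in> comps U \<Longrightarrow>
    typing M ((\<Gamma>((x, L) \<mapsto> V)) |` fv M) T"
proof (induction arbitrary: V T rule: typing.induct)
  case (arr_I M1 \<Gamma> y K V' T')
  then have K: "K = L" and eq: "lam y L M1 = lam x L M" and VT: "V' = V" "T' = T"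
    by (auto simp: lam_def)
  have M1: "M1 \<in> terms" using arr_I.hyps typing_wf by blast
  have dom: "insert (y, L) (dom \<Gamma>) = fv M1"
    using typing_dom[OF arr_I.hyps(1)] K by (simp del: fun_upd_apply)
  then have y: "(y, L) \<in> fv M1" by blast
  note eqs = lam_eq_perm[OF M1 arr_I.prems(2) eq y]
  let ?f = "transpose y x"
  \<comment> \<open>Neither name is declared in \<Gamma> under any index, so the swap only moves the
    declaration of the bound variable.\<close>
  have none: "\<Gamma> (x, B) = None" "\<Gamma> (y, B) = None" for B
    using eqs(2) dom arr_I.hyps(2) K by (metis domIff insertI2)+
  have "env_perm ?f (\<Gamma>((y, L) \<mapsto> V)) (w, B) = (\<Gamma>((x, L) \<mapsto> V)) (w, B)" for w B
    using none by (cases "w = x"; cases "w = y") auto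
  then have "env_perm ?f (\<Gamma>((y, L) \<mapsto> V)) = \<Gamma>((x, L) \<mapsto> V)" by (intro ext) (metis surj_pair)
  moreover have "typing (perm ?f M1) (env_perm ?f (\<Gamma>((y, L) \<mapsto> V))) T"
    using arr_I.hyps(1) K VT by (intro typing_perm) simp_all
  ultimately have "typing M (\<Gamma>((x, L) \<mapsto> V)) T" using eqs(1) by simp
  with typing_dom restrict_dom show ?case by (metis subset_refl)
next
  case (arr_I' M1 \<Gamma> T' y K)
  then have K: "K = L" and eq: "lam y L M1 = lam x L M" and VT: "T' = T"
    by (auto simp: lam_def)
  have M1: "M1 \<in> terms" and dom: "dom \<Gamma> = fv M1" using arr_I'.hyps typing_wf by blast+
  then have "M = M1" "(x, L) \<notin> fv M1"
    using lam_eq_fresh[OF M1 arr_I'.prems(2) eq] arr_I'.hyps(2) K by auto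
  moreover from this have "(\<Gamma>((x, L) \<mapsto> V)) |` fv M1 = \<Gamma>"
    using dom restrict_dom[of \<Gamma> "fv M1"] by simp
  ultimately show ?case using arr_I'.hyps(1) VT by (simp del: fun_upd_apply)
next
  case (inter_I M1 \<Gamma> U1 U2)
  then show ?case by auto
next
  case (sub M1 \<Gamma> U \<Gamma>' U')
  have st: "sub_ty U U'" and cov: "covers \<Gamma>' \<Gamma>" using sub_typingD[OF sub.hyps(2)] by auto
  obtain b where b: "([], b) \<in> comps U" "sub_comp b (Inr (V, T))"
    using sub_ty_comps[OF st sub.prems(3)] by blast
  then obtain V0 T0 where b0: "b = Inr (V0, T0)" "sub_ty V V0" "sub_ty T0 T"
    by (cases b) auto
  have "typing M ((\<Gamma>((x, L) \<mapsto> V0)) |` fv M) T0"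
    using sub.IH sub.prems b b0 by blast
  moreover have "covers (\<Gamma>'((x, L) \<mapsto> V)) ((\<Gamma>((x, L) \<mapsto> V0)) |` fv M)"
    using cov b0 by (auto simp: covers_def restrict_map_def)
  ultimately show ?case using b0 typing_weaken by blast
\<comment> \<open>\<open>omega\<close> yields no component and \<open>exp\<close> only components
  with non-empty prefix; the other subjects are not abstractions.\<close>
qed (auto simp: lam_def)

lemma typing_lam_inv:
  assumes "typing (lam x L M) \<Gamma> (Arr V T)" "M \<in> terms"
  shows "typing M ((\<Gamma>((x, L) \<mapsto> V)) |` fv M) T"
  using typing_lam_inv_aux[OF assms(1) HOL.refl assms(2)] by simp

text \<open>Different components can stem from different argument types \<open>V\<close>, hence the
  statement for one component at a time.\<close>

lemma typing_App_inv_aux: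
  "typing P \<Gamma> U \<Longrightarrow> P = App M N \<Longrightarrow> ([], c) \<in> comps U \<Longrightarrow>
    \<exists>\<Gamma>1 \<Gamma>2 V. typing M \<Gamma>1 (Arr V (ty_of_comp c)) \<and> typing N \<Gamma>2 V \<and> covers \<Gamma> \<Gamma>1 \<and> covers \<Gamma> \<Gamma>2"
proof (induction arbitrary: c rule: typing.induct)
  case (arr_E M1 \<Gamma>1 U T M2 \<Gamma>2)
  have "ty_of_comp c = T" using comps_TT[OF arr_E.hyps(4)] arr_E.prems by auto
  with arr_E.hyps arr_E.prems covers_inter[OF arr_E.hyps(1,2)] show ?case by auto
next
  case (inter_I M1 \<Gamma> U1 U2)
  then show ?case by auto
next
  case (sub M1 \<Gamma> U \<Gamma>' U')
  have st: "sub_ty U U'" and cov: "covers \<Gamma>' \<Gamma>" using sub_typingD[OF sub.hyps(2)] by auto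
  have UU: "U \<in> UU" "U' \<in> UU" using st sub_ty_wf by auto
  obtain b where b: "([], b) \<in> comps U" "sub_comp b c"
    using sub_ty_comps[OF st sub.prems(2)] by blast
  then obtain \<Gamma>1 \<Gamma>2 V where V: "typing M \<Gamma>1 (Arr V (ty_of_comp b))" "typing N \<Gamma>2 V"
    "covers \<Gamma> \<Gamma>1" "covers \<Gamma> \<Gamma>2"
    using sub.IH sub.prems by blast
  have "sub_ty (Arr V (ty_of_comp b)) (Arr V (ty_of_comp c))"
    using sub_ty_of_comp[OF UU b(1) sub.prems(2) b(2)] sub_ty_refl[OF V(2)]
      ty_of_comp_TT[OF UU(1) b(1)] ty_of_comp_TT[OF UU(2) sub.prems(2)] by (intro sub_ty.arr)
  then have "typing M \<Gamma>1 (Arr V (ty_of_comp c))" using V(1) typing_sub_ty by blast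
  with V cov covers_trans show ?case by meson
qed (auto simp: lam_def)

lemma typing_App_inv:
  assumes "typing (App M N) \<Gamma> T" "T \<in> TT"
  obtains \<Gamma>1 \<Gamma>2 V where "typing M \<Gamma>1 (Arr V T)" "typing N \<Gamma>2 V" "covers \<Gamma> \<Gamma>1" "covers \<Gamma> \<Gamma>2"
  using comps_TT[OF assms(2)] typing_App_inv_aux[OF assms(1) HOL.refl] by auto

section \<open>Substitution lemma\<close>

lemma typing_subst_fresh:
  assumes "typing M \<Gamma> U" "(x, L) \<notin> fv M" "covers \<Theta> (\<Gamma>((x, L) := None))"
  shows "typing (subst M x L N) (\<Theta> |` fv (subst M x L N)) U"
proof -
  have "\<Gamma>((x, L) := None) = \<Gamma>" using assms typing_dom by (metis domIff fun_upd_triv)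
  with assms typing_weaken sub_ty_refl show ?thesis by (metis subst_fresh)
qed

text \<open>
  Stating the result for every environment \<open>\<Theta>\<close> below the two given ones makes the application case
  trivial, as \<open>\<Theta>\<close> is then shared by both subterms and \<open>\<sqinter>\<close> is idempotent.
\<close>

lemma typing_subst:
  fixes \<Gamma> :: "'a env"
  assumes "typing M \<Gamma> U" "typing N \<Delta> V" "deg N = L" "joinable (fv M) (fv N)"
    and "\<And>V'. \<Gamma> (x, L) = Some V' \<Longrightarrow> sub_ty V V'"
    and "covers \<Theta> (\<Gamma>((x, L) := None))" "(x, L) \<in> fv M \<Longrightarrow> covers \<Theta> \<Delta>"
  shows "typing (subst M x L N) (\<Theta> |` fv (subst M x L N)) U"
  using assms
proof (induction arbitrary: L N \<Delta> V \<Theta> rule: typing.induct)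
  case (ax T y)
  show ?case
  proof (cases "(x, L) = (y, [])")
    case True
    then show ?thesis using ax.prems typing_weaken by auto
  next
    case False
    then show ?thesis
      using typing_subst_fresh[OF typing.ax[OF ax.hyps] _ ax.prems(5)] by simp
  qed
next
  case (omega M)
  let ?S = "subst M x L N"
  have "?S \<in> terms" using omega typing_wf by (blast intro: subst_terms)
  moreover have "covers \<Theta> (env_omega ?S :: 'a env)"
  proof (rule coversI)
    fix v :: ivar and W :: "'a ty"
    assume W: "env_omega ?S v = Some W"
    obtain w B where v: "v = (w, B)" by (cases v)
    from W v have S: "(w, B) \<in> fv ?S" and WB: "W = Omega B"
      by (auto simp: env_omega_def split: if_splits)
    from S consider "(w, B) \<in> fv M" "(w, B) \<noteq> (x, L)" | "(x, L) \<in> fv M" "(w, B) \<in> fv N"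
      by (auto simp: fv_subst split: if_splits)
    then show "\<exists>A. \<Theta> v = Some A \<and> sub_ty A W"
    proof cases
      case 1
      then have "((env_omega M)((x, L) := None)) v = Some (Omega B :: 'a ty)"
        using v by (auto simp: env_omega_def)
      with coversD[OF omega.prems(5)] WB show ?thesis by blast
    next
      case 2
      then obtain D where D: "\<Delta> v = Some D" using typing_dom[OF omega.prems(1)] v by blast
      then have "D \<in> UU" "tdeg D = B"
        using typing_UU[OF omega.prems(1)] typing_tdeg[OF omega.prems(1)] v by blast+
      then have "sub_ty D W" using sub_ty_Omega WB by blast
      with coversD[OF omega.prems(6)[OF 2(1)] D] show ?thesis using sub_ty.trans by blast
    qed
  qed
  moreover have "deg ?S = deg M" using omega.prems by (simp add: deg_subst)
  ultimately show ?case
    using typing_weaken[OF typing.omega, of ?S \<Theta> "Omega (deg M)"]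
    by (simp add: sub_ty.refl TT_UU.omega)
next
  case (arr_I M \<Gamma> y K W T)
  show ?case
  proof (cases "(x, L) \<in> fv (lam y K M)")
    case False
    show ?thesis
      using typing_subst_fresh[OF typing.arr_I[OF arr_I.hyps] False arr_I.prems(5)] .
  next
    case True
    have Mt: "M \<in> terms" and W: "W \<in> UU"
      using typing_wf[OF arr_I.hyps(1)] typing_UU[OF arr_I.hyps(1), of "(y, K)"] by auto
    have dom: "insert (y, K) (dom \<Gamma>) = fv M"
      using typing_dom[OF arr_I.hyps(1)] by (simp del: fun_upd_apply)
    then have y: "(y, K) \<in> fv M" by blast
    have xy: "(x, L) \<noteq> (y, K)" and xM: "(x, L) \<in> fv M" using True by auto
    obtain f where f: "\<And>w. f (f w) = w" "inj f" "f x = x"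
      "\<And>w B. (w, B) \<in> fv (lam y K M) \<Longrightarrow> f w = w"
      "(y, K) \<notin> fv (perm f N)" "joinable (fv M) (fv (perm f N))"
      using avoid_capture[OF Mt y True arr_I.prems(3)] by metis
    \<comment> \<open>\<Theta> has to follow the renaming of \<open>N\<close>. Overwriting
      \<open>y\<close> is harmless, since \<open>perm f N\<close> does not contain it.\<close>
    let ?S = "subst M x L (perm f N)" and ?T = "(env_perm f \<Theta>)((y, K) \<mapsto> W)"
      and ?R = "subst (lam y K M) x L N"
    have N: "typing (perm f N) (env_perm f \<Delta>) V" using arr_I.prems(1) f(1) by (rule typing_perm)
    have "typing ?S (?T |` fv ?S) T"
    proof (rule arr_I.IH[OF N _ f(6)])
      show "deg (perm f N) = L" using arr_I.prems by simp
    next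
      fix V' assume "(\<Gamma>((y, K) \<mapsto> W)) (x, L) = Some V'"
      then show "sub_ty V V'" using xy arr_I.prems(4) by auto
    next
      show "covers ?T ((\<Gamma>((y, K) \<mapsto> W))((x, L) := None))"
      proof (rule coversI)
        fix v A assume A: "((\<Gamma>((y, K) \<mapsto> W))((x, L) := None)) v = Some A"
        obtain w B where v: "v = (w, B)" by (cases v)
        show "\<exists>W'. ?T v = Some W' \<and> sub_ty W' A"
        proof (cases "v = (y, K)")
          case True
          with A W xy show ?thesis by (auto intro: sub_ty.refl)
        next
          case False
          with A have A': "(\<Gamma>((x, L) := None)) v = Some A" by (auto split: if_splits)
          then have "v \<in> dom \<Gamma>" by (auto split: if_splits)
          with dom False v have "f w = w" by (intro f(4)[of w B]) auto
          with coversD[OF arr_I.prems(5) A'] False v show ?thesis by auto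
        qed
      qed
    next
      show "covers ?T (env_perm f \<Delta>)"
      proof (rule coversI)
        fix v A assume A: "env_perm f \<Delta> v = Some A"
        obtain w B where v: "v = (w, B)" by (cases v)
        have "(w, B) \<noteq> (y, K)" using f(5) typing_dom[OF N] A v by blast
        with coversD[OF arr_I.prems(6)[OF True], of "(f w, B)" A] A v
        show "\<exists>W'. ?T v = Some W' \<and> sub_ty W' A" by auto
      qed
    qed
    moreover have "(y, K) \<in> fv ?S" using y xy unfolding fv_subst by blast
    then have "?T |` fv ?S = (env_perm f \<Theta> |` fv (lam y K ?S))((y, K) \<mapsto> W)"
      by (intro ext) (simp add: restrict_map_def)
    ultimately have "typing (lam y K ?S) (env_perm f \<Theta> |` fv (lam y K ?S)) (Arr W T)"
      using arr_I.hyps by (intro typing.arr_I) (simp_all del: fun_upd_apply)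
    then have ty: "typing (perm f (lam y K ?S))
      (env_perm f (env_perm f \<Theta> |` fv (lam y K ?S))) (Arr W T)"
      using f(1) by (rule typing_perm)
    have "lam y K ?S = subst (lam y K M) x L (perm f N)"
      using xy f(5) by (subst subst_lam) auto
    moreover have "perm f (lam y K M) = lam y K M" using f(4) by (rule perm_cong)
    ultimately have R: "perm f (lam y K ?S) = ?R"
      using f by (simp add: perm_subst perm_perm)
    have "env_perm f (env_perm f \<Theta> |` fv (lam y K ?S)) (w, B) = (\<Theta> |` fv ?R) (w, B)" for w B
      using fv_perm_iff[OF f(2), of "f w" B "lam y K ?S"] f(1)
      unfolding R by (simp add: restrict_map_def del: fv_lam)
    then have "env_perm f (env_perm f \<Theta> |` fv (lam y K ?S)) = \<Theta> |` fv ?R"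
      by (intro ext) (metis surj_pair)
    with ty R show ?thesis by simp
  qed
next
  case (arr_I' M \<Gamma> T y K)
  let ?S = "subst M x L N"
  have y: "(y, K) \<notin> fv M" using arr_I'.hyps typing_dom by blast
  then have fvM: "fv (lam y K M) = fv M" by simp
  have S: "typing ?S (\<Theta> |` fv ?S) T"
    using arr_I'.prems unfolding fvM by (rule arr_I'.IH)
  obtain z where "z \<notin> fst ` fv ?S" using ex_fresh finite_fv by blast
  then have z: "(z, K) \<notin> fv ?S" by force
  then have eq: "subst (lam y K M) x L N = lam z K ?S" and fvS: "fv (lam z K ?S) = fv ?S"
    using y by (simp_all add: lam_fresh)
  show ?case
    unfolding eq fvS using S z arr_I'.hyps(3)
    by (intro typing.arr_I') (auto simp: restrict_map_def split: if_splits)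
next
  case (arr_E M1 \<Gamma>1 U T M2 \<Gamma>2)
  let ?S1 = "subst M1 x L N" and ?S2 = "subst M2 x L N"
  note cov = covers_inter[OF arr_E.hyps(1,2)]
  have c: "covers \<Theta> (\<Gamma>((x, L) := None))" "\<And>V'. \<Gamma> (x, L) = Some V' \<Longrightarrow> sub_ty V V'"
    if "covers (env_inter \<Gamma>1 \<Gamma>2) \<Gamma>" for \<Gamma>
  proof -
    have "covers ((env_inter \<Gamma>1 \<Gamma>2)((x, L) := None)) (\<Gamma>((x, L) := None))"
      using that by (auto simp: covers_def)
    then show "covers \<Theta> (\<Gamma>((x, L) := None))" using arr_E.prems(5) covers_trans by blast
    fix V' assume "\<Gamma> (x, L) = Some V'"
    from coversD[OF that this] arr_E.prems(4) sub_ty.trans show "sub_ty V V'" by blast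
  qed
  have j: "joinable (fv M1) (fv N)" "joinable (fv M2) (fv N)"
    using arr_E.prems(3) by (auto simp: joinable_def)
  have S1: "typing ?S1 (\<Theta> |` fv ?S1) (Arr U T)"
    by (rule arr_E.IH(1)[OF arr_E.prems(1,2) j(1) c(2,1)[OF cov(1)]]) (simp_all add: arr_E.prems(6))
  have S2: "typing ?S2 (\<Theta> |` fv ?S2) U"
    by (rule arr_E.IH(2)[OF arr_E.prems(1,2) j(2) c(2,1)[OF cov(2)]]) (simp_all add: arr_E.prems(6))
  have "typing (App M1 M2) (env_inter \<Gamma>1 \<Gamma>2) T" using arr_E.hyps by (rule typing.arr_E)
  then have "subst (App M1 M2) x L N \<in> terms"
    using arr_E.prems typing_wf by (blast intro: subst_terms)
  then have "joinable (fv ?S1) (fv ?S2)" by (simp add: terms_App_iff)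
  then have "joinable (dom (\<Theta> |` fv ?S1)) (dom (\<Theta> |` fv ?S2))"
    using typing_dom[OF S1] typing_dom[OF S2] by simp
  from typing.arr_E[OF S1 S2 this arr_E.hyps(4)]
  have "typing (App ?S1 ?S2) (env_inter (\<Theta> |` fv ?S1) (\<Theta> |` fv ?S2)) T" .
  moreover have "env_inter (\<Theta> |` fv ?S1) (\<Theta> |` fv ?S2) = \<Theta> |` (fv ?S1 \<union> fv ?S2)"
    by (auto simp: fun_eq_iff env_inter_def restrict_map_def split: option.splits)
  ultimately show ?case by simp
next
  case (inter_I M \<Gamma> U1 U2)
  then show ?case by (intro typing.inter_I) blast+
next
  case (exp M \<Gamma> U j)
  show ?case
  proof (cases "(x, L) \<in> fv (lift j M)")
    \<comment> \<open>Here \<open>L\<close> need not start with \<open>j\<close>, so lowering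
      \<open>N\<close> is not an option.\<close>
    case False
    show ?thesis
      using typing_subst_fresh[OF typing.exp[OF exp.hyps] False exp.prems(5)] .
  next
    case True
    then obtain K where L: "L = j # K" and xM: "(x, K) \<in> fv M" by (auto simp: fv_lift_iff)
    obtain N' \<Delta>' V' where low: "N = lift j N'" "\<Delta> = env_exp j \<Delta>'" "V = Exp j V'" "typing N' \<Delta>' V'"
      using typing_lower[OF exp.prems(1)] exp.prems(2) L by metis
    let ?S = "subst M x K N'" and ?G = "\<Gamma>((x, K) := None)"
    have upd: "(env_exp j \<Gamma>)((x, L) := None) = env_exp j ?G"
      unfolding L by (auto simp: fun_eq_iff env_exp_def split: list.splits)
    have cG: "covers \<Theta> (env_exp j ?G)" using exp.prems(5) upd by simp
    have cD: "covers \<Theta> (env_exp j \<Delta>')" using exp.prems(6) True low by simp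
    have "typing ?S (env_drop j \<Theta> |` fv ?S) U"
    proof (rule exp.IH[OF low(4)])
      show "deg N' = K" using exp.prems(2) low L by (simp add: deg_lift)
      show "joinable (fv M) (fv N')" using exp.prems(3) low by simp
      show "covers (env_drop j \<Theta>) ?G" using cG by (rule covers_env_drop)
      show "covers (env_drop j \<Theta>) \<Delta>'" using cD by (rule covers_env_drop)
      fix A assume "\<Gamma> (x, K) = Some A"
      then have "sub_ty (Exp j V') (Exp j A)"
        using exp.prems(4) low L by (simp add: env_exp_apply)
      then show "sub_ty V' A" using sub_ty_tdrop by fastforce
    qed
    then have ty: "typing (lift j ?S) (env_exp j (env_drop j \<Theta> |` fv ?S)) (Exp j U)"
      by (rule typing.exp)
    \<comment> \<open>\<Theta> is arbitrary, so \<open>env_exp_drop\<close> does not apply. That a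
      type \<open>W\<close> in it is a type of degree \<open>j # ...\<close> follows from its lying
      below a type \<open>Exp j D\<close> of a covered environment.\<close>
    have "covers \<Theta> (env_exp j (env_drop j \<Theta> |` fv ?S))"
    proof (rule coversI)
      fix v A assume A: "env_exp j (env_drop j \<Theta> |` fv ?S) v = Some A"
      obtain w B' where v: "v = (w, B')" by (cases v)
      from env_exp_SomeD[OF A[unfolded v]] obtain B C
        where B: "B' = j # B" "(env_drop j \<Theta> |` fv ?S) (w, B) = Some C" "A = Exp j C" by blast
      then have wS: "(w, B) \<in> fv ?S" and "env_drop j \<Theta> (w, B) = Some C"
        by (auto simp: restrict_map_def split: if_splits)
      then obtain W where W: "\<Theta> (w, j # B) = Some W" "C = tdrop W" by (auto simp: env_drop_def)
      have "(w, B) \<in> dom ?G \<or> (w, B) \<in> dom \<Delta>'"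
        using wS typing_dom[OF exp.hyps] typing_dom[OF low(4)] by (auto simp: fv_subst split: if_splits)
      then obtain D where "?G (w, B) = Some D \<or> \<Delta>' (w, B) = Some D" by blast
      then have "sub_ty W (Exp j D)"
        using coversD[OF cG, of "(w, j # B)" "Exp j D"] coversD[OF cD, of "(w, j # B)" "Exp j D"] W(1)
        by (auto simp: env_exp_apply simp del: fun_upd_apply)
      then have "W \<in> UU" "tdeg W = j # tdeg D" using sub_ty_wf by fastforce+
      then have "Exp j C = W" using Exp_tdrop W by blast
      with B W v \<open>W \<in> UU\<close> show "\<exists>W. \<Theta> v = Some W \<and> sub_ty W A" by (auto intro: sub_ty.refl)
    qed
    from typing_weaken[OF ty this sub_ty_refl[OF ty]] show ?thesis
      by (simp add: lift_subst L low)
  qed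
next
  case (sub M \<Gamma> U \<Gamma>' U')
  have st: "sub_ty U U'" and cov: "covers \<Gamma>' \<Gamma>" using sub_typingD[OF sub.hyps(2)] by auto
  have "typing (subst M x L N) (\<Theta> |` fv (subst M x L N)) U"
  proof (rule sub.IH[OF sub.prems(1-3)])
    have "covers (\<Gamma>'((x, L) := None)) (\<Gamma>((x, L) := None))" using cov by (auto simp: covers_def)
    then show "covers \<Theta> (\<Gamma>((x, L) := None))" using sub.prems(5) covers_trans by blast
    show "(x, L) \<in> fv M \<Longrightarrow> covers \<Theta> \<Delta>" using sub.prems(6) .
    fix V' assume "\<Gamma> (x, L) = Some V'"
    from coversD[OF cov this] sub.prems(4) sub_ty.trans show "sub_ty V V'" by blast
  qed
  with st typing_sub_ty show ?case by blast
qed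


section \<open>Subject reduction\<close>

lemma typing_red:
  fixes \<Gamma> :: "'a env"
  shows "typing M \<Gamma> U \<Longrightarrow> red M N \<Longrightarrow> typing N (\<Gamma> |` fv N) U"
proof (induction arbitrary: N rule: typing.induct)
  case (ax T x)
  then show ?case using red_Var by blast
next
  case (omega M)
  have "N \<in> terms" "fv N \<subseteq> fv M" "deg N = deg M" using red_wf[OF omega.prems] by auto
  moreover from this have "env_omega M |` fv N = (env_omega N :: 'a env)"
    by (auto simp: fun_eq_iff env_omega_def restrict_map_def)
  ultimately show ?case using typing.omega[of N] by simp
next
  case (arr_I M \<Gamma> x L U T)
  have M: "M \<in> terms" and UU: "U \<in> UU" "tdeg U = L"
    using typing_wf[OF arr_I.hyps(1)] typing_UU[OF arr_I.hyps(1), of "(x, L)"]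
      typing_tdeg[OF arr_I.hyps(1), of x L] by auto
  have T: "sub_ty T T" using arr_I.hyps(3) by (intro sub_ty.refl TT_UU.TT)
  from arr_I.prems M show ?case
  proof (cases rule: red_lam_cases)
    case (lam N')
    have ty: "typing N' ((\<Gamma>((x, L) \<mapsto> U)) |` fv N') T" using arr_I.IH lam by blast
    have nx: "(x, L) \<notin> dom (\<Gamma> |` fv (lam x L N'))" by simp
    show ?thesis
    proof (cases "(x, L) \<in> fv N'")
      case True
      then have "(\<Gamma>((x, L) \<mapsto> U)) |` fv N' = (\<Gamma> |` fv N)((x, L) \<mapsto> U)"
        using lam by (auto simp: fun_eq_iff restrict_map_def)
      with ty have "typing N' ((\<Gamma> |` fv N)((x, L) \<mapsto> U)) T" by (simp only:)
      then show ?thesis unfolding lam(1) using nx arr_I.hyps(3) by (rule typing.arr_I)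
    next
      case False
      then have "(\<Gamma>((x, L) \<mapsto> U)) |` fv N' = \<Gamma> |` fv N"
        using lam by (auto simp: fun_eq_iff restrict_map_def)
      with ty have "typing N' (\<Gamma> |` fv N) T" by (simp only:)
      \<comment> \<open>The step has erased \<open>x\<close>: the domain of the arrow becomes
        \<open>Omega L\<close>, a supertype of \<open>U\<close>, and contravariance leads back to
        \<open>U\<close>.\<close>
      then have "typing N (\<Gamma> |` fv N) (Arr (Omega L) T)"
        unfolding lam(1) using nx arr_I.hyps(3) by (rule typing.arr_I')
      moreover have "sub_ty (Arr (Omega L) T) (Arr U T)"
        using sub_ty_Omega UU T arr_I.hyps by (intro sub_ty.arr) auto
      ultimately show ?thesis by (rule typing_sub_ty)
    qed
  next
    case eta
    obtain \<Gamma>1 \<Gamma>2 V where V: "typing N \<Gamma>1 (Arr V T)" "typing (Var x L) \<Gamma>2 V"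
      "covers (\<Gamma>((x, L) \<mapsto> U)) \<Gamma>1" "covers (\<Gamma>((x, L) \<mapsto> U)) \<Gamma>2"
      using typing_App_inv[OF arr_I.hyps(1)[unfolded eta(1)] arr_I.hyps(3)] by metis
    obtain W where W: "\<Gamma>2 = [(x, L) \<mapsto> W]" "sub_ty W V" using typing_Var_inv[OF V(2)] by metis
    \<comment> \<open>The argument \<open>x\<close> has type \<open>V\<close> only through
      \<open>U\<close>, so \<open>V\<close> is a supertype of \<open>U\<close> and
      \<open>Arr V T\<close> lies below \<open>Arr U T\<close>.\<close>
    with coversD[OF V(4), of "(x, L)" W] have "sub_ty U V" using sub_ty.trans by auto
    then have "sub_ty (Arr V T) (Arr U T)" using T arr_I.hyps by (intro sub_ty.arr)
    moreover have "covers \<Gamma> \<Gamma>1"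
    proof (rule coversI)
      fix v A assume A: "\<Gamma>1 v = Some A"
      then have "v \<noteq> (x, L)" using typing_dom[OF V(1)] eta(2) by blast
      with coversD[OF V(3) A] show "\<exists>W. \<Gamma> v = Some W \<and> sub_ty W A" by auto
    qed
    ultimately show ?thesis using V(1) typing_weaken by blast
  qed
next
  case (arr_I' M \<Gamma> T x L)
  have M: "M \<in> terms" "dom \<Gamma> = fv M" using typing_wf[OF arr_I'.hyps(1)] by auto
  from arr_I'.prems M(1) show ?case
  proof (cases rule: red_lam_cases)
    case (lam N')
    then have "(x, L) \<notin> fv N'" using red_wf arr_I'.hyps(2) M by blast
    then have "fv N = fv N'" using lam by simp
    with arr_I' lam show ?thesis by (auto intro!: typing.arr_I')
  next
    case eta
    \<comment> \<open>Impossible: an \<eta>-redex has its variable free in the body, whereas here it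
      is undeclared.\<close>
    with M arr_I'.hyps show ?thesis by auto
  qed
next
  case (arr_E M1 \<Gamma>1 U T M2 \<Gamma>2)
  note cov = covers_inter[OF arr_E.hyps(1,2)]
  have T: "sub_ty T T" using arr_E.hyps(4) by (intro sub_ty.refl TT_UU.TT)
  have dom: "dom \<Gamma>1 = fv M1" "dom \<Gamma>2 = fv M2" using arr_E.hyps typing_dom by blast+
  from arr_E.prems show ?case
  proof (cases rule: red_App_cases)
    case (left N')
    have N': "typing N' (\<Gamma>1 |` fv N') (Arr U T)" using arr_E.IH left by blast
    have "joinable (dom (\<Gamma>1 |` fv N')) (dom \<Gamma>2)"
      using arr_E.hyps(3) by (auto simp: joinable_def)
    then have "typing N (env_inter (\<Gamma>1 |` fv N') \<Gamma>2) T"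
      unfolding left using N' arr_E.hyps by (intro typing.arr_E)
    moreover have "covers (env_inter \<Gamma>1 \<Gamma>2) (env_inter (\<Gamma>1 |` fv N') \<Gamma>2)"
      using cov by (rule covers_inter_least[OF covers_restrict])
    ultimately show ?thesis using T typing_weaken by blast
  next
    case (right N')
    have N': "typing N' (\<Gamma>2 |` fv N') U" using arr_E.IH right by blast
    have "joinable (dom \<Gamma>1) (dom (\<Gamma>2 |` fv N'))"
      using arr_E.hyps(3) by (auto simp: joinable_def)
    then have "typing N (env_inter \<Gamma>1 (\<Gamma>2 |` fv N')) T"
      unfolding right using N' arr_E.hyps by (intro typing.arr_E)
    moreover have "covers (env_inter \<Gamma>1 \<Gamma>2) (env_inter \<Gamma>1 (\<Gamma>2 |` fv N'))"
      using cov by (intro covers_inter_least covers_restrict)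
    ultimately show ?thesis using T typing_weaken by blast
  next
    case (beta x L Q)
    have "typing Q ((\<Gamma>1((x, L) \<mapsto> U)) |` fv Q) T"
      using typing_lam_inv arr_E.hyps(1) beta by blast
    moreover have "sub_ty U V'" if "((\<Gamma>1((x, L) \<mapsto> U)) |` fv Q) (x, L) = Some V'" for V'
      using that sub_ty_refl[OF arr_E.hyps(2)] by (auto simp: restrict_map_def split: if_splits)
    \<comment> \<open>The environment of the whole application serves as \<Theta> in
      \<open>typing_subst\<close>: it lies below both parts.\<close>
    moreover have "covers (env_inter \<Gamma>1 \<Gamma>2) (((\<Gamma>1((x, L) \<mapsto> U)) |` fv Q)((x, L) := None))"
      using cov(1) by (auto simp: covers_def restrict_map_def)
    ultimately show ?thesis
      unfolding beta(2) using beta arr_E.hyps(2) cov(2) by (intro typing_subst)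
  qed
next
  case (inter_I M \<Gamma> U1 U2)
  then show ?case by (blast intro: typing.inter_I)
next
  case (exp M \<Gamma> U j)
  obtain N' where N': "N = lift j N'" "red M N'" using red_lower[OF exp.prems HOL.refl] by blast
  have "env_exp j \<Gamma> |` fv (lift j N') = env_exp j (\<Gamma> |` fv N')"
    by (auto simp: fun_eq_iff env_exp_def restrict_map_def fv_lift_iff split: list.splits)
  with typing.exp[OF exp.IH[OF N'(2)], of j] N' show ?case by simp
next
  case (sub M \<Gamma> U \<Gamma>' U')
  have st: "sub_ty U U'" and cov: "covers \<Gamma>' \<Gamma>" using sub_typingD[OF sub.hyps(2)] by auto
  show ?case using sub.IH[OF sub.prems] covers_restrict[OF cov] st by (rule typing_weaken)
qed

theorem theorem4:
  fixes \<Gamma> :: "'a env"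
  assumes "typing M \<Gamma> U" and "beta_eta\<^sup>*\<^sup>* M N"
  shows "typing N (\<Gamma> |` fv N) U"
  using assms(2)
proof (induction rule: rtranclp_induct)
  case base
  then show ?case using assms(1) typing_dom[OF assms(1)] by (simp add: restrict_dom)
next
  case (step P Q)
  then have red: "red P Q" using beta_eta_red by blast
  \<comment> \<open>Steps create no free variables, so the successive restrictions compose to the
    last one.\<close>
  with red_wf have "fv P \<inter> fv Q = fv Q" by blast
  with typing_red[OF step.IH red] show ?case by simp
qed

end
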